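(* Let $y=\beta_0+\epsilon$ with $\epsilon\sim\mathcal N(0,\sigma^2 I)$ in $\mathbb R^n$, let $\Delta\in\mathbb R^{r\times n}$ be a linear operator, and let $\mathcal S_\Delta(1)=\{x\in\mathrm{row}(\Delta):\|\Delta x\|_1\le 1\}$. Suppose that there exists a constant $w<2$ such that for $n$ large enough, $$\log N(\delta,\mathcal S_\Delta(1),\|\cdot\|_2)\le E\left(\frac{\sqrt n}{\delta}\right)^w\qquad\text{for }\delta>0,$$ where $E$ can depend on $n$. Then $$\max_{x\in\mathcal S_\Delta(1)}\frac{\epsilon^\top x}{\|x\|_2^{1-w/2}}=O_{\mathbb P}(K)\qquad\text{with } K=\sqrt E\,n^{w/4},$$ and as a result, for $$\lambda=\Theta\left(E^{\frac1{1+w/2}}\,n^{\frac{w/2}{1+w/2}}\,\|\Delta\beta_0\|_1^{-\frac{1-w/2}{1+w/2}}\right),$$ the generalized lasso estimate $$\hat\beta=\operatorname*{argmin}_{\beta\in\mathbb R^n}\ \tfrac12\|y-\beta\|_2^2+\lambda\|\Delta\beta\|_1$$ has average squared error $$\frac{\|\hat\beta-\beta_0\|_2^2}{n}=O_{\mathbb P}\left(\frac{\mathrm{nullity}(\Delta)}{n}+E^{\frac1{1+w/2}}\,n^{-\frac1{1+w/2}}\cdot\|\Delta\beta_0\|_1^{\frac{w}{1+w/2}}\right).$$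
   Context: Asymptotics are as $n\to\infty$; $\sigma>0$ is a fixed constant, while $\Delta$, its number of rows $r$, the mean vector $\beta_0\in\mathbb R^n$, $E$ and $\lambda\ge 0$ may depend on $n$. $\mathrm{row}(\Delta)$ is the row space of $\Delta$ and $\mathrm{nullity}(\Delta)$ the dimension of its null space. For a set $S$, the covering number $N(\delta,S,\|\cdot\|)$ is the fewest number of balls of radius $\delta$ that cover $S$, with respect to the norm $\|\cdot\|$. The maximum of the ratio is over nonzero $x$. $X_n=O_{\mathbb P}(a_n)$ means that $X_n/a_n$ is bounded in probability. A statement made "with $\lambda=\Theta(a_n)$" means that the conclusion holds when the deterministic tuning parameter $\lambda$ is taken to be of exact order $a_n$, with a suitable choice of constant not depending on $n$. *)

theory Defs
  imports "HOL-Probability.Probability" "Jordan_Normal_Form.Matrix_Kernel"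
begin

definition l1_norm :: "real vec \<Rightarrow> real" where
  "l1_norm v = (\<Sum>i<dim_vec v. \<bar>v $ i\<bar>)"

definition l2_norm :: "real vec \<Rightarrow> real" where
  "l2_norm v = L2_set (\<lambda>i. v $ i) {..<dim_vec v}"

definition unit_row_set :: "nat \<Rightarrow> real mat \<Rightarrow> real vec set" where
  "unit_row_set n D = {x \<in> vec_space.row_space n D. l1_norm (D *\<^sub>v x) \<le> 1}"

definition l2_ball :: "nat \<Rightarrow> real vec \<Rightarrow> real \<Rightarrow> real vec set" where
  "l2_ball n c \<delta> = {x \<in> carrier_vec n. l2_norm (x - c) \<le> \<delta>}"

text \<open>Balls are closed, and their centres are arbitrary points of \<open>\<real>\<^sup>n\<close>. The value is
  \<open>\<infinity>\<close> if no finite cover exists.\<close>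

definition covering_number :: "nat \<Rightarrow> real \<Rightarrow> real vec set \<Rightarrow> enat" where
  "covering_number n \<delta> S =
     (INF C \<in> {C. finite C \<and> C \<subseteq> carrier_vec n \<and> S \<subseteq> (\<Union>c\<in>C. l2_ball n c \<delta>)}. enat (card C))"

definition ln_enat :: "enat \<Rightarrow> ereal" where
  "ln_enat N = (case N of enat m \<Rightarrow> ereal (ln (real m)) | \<infinity> \<Rightarrow> \<infinity>)"

text \<open>The law of \<open>e\<close> is \<open>N(0, \<sigma>\<^sup>2 I)\<close> on \<open>\<real>\<^sup>n\<close>, expressed through independent
  \<open>N(0, \<sigma>\<^sup>2)\<close> coordinates.\<close>

definition gaussian_noise :: "'a measure \<Rightarrow> nat \<Rightarrow> real \<Rightarrow> ('a \<Rightarrow> real vec) \<Rightarrow> bool" where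
  "gaussian_noise M n \<sigma> e \<longleftrightarrow>
     (\<forall>\<omega>\<in>space M. e \<omega> \<in> carrier_vec n) \<and>
     prob_space.indep_vars M (\<lambda>_. borel) (\<lambda>i \<omega>. e \<omega> $ i) {..<n} \<and>
     (\<forall>i<n. distributed M lborel (\<lambda>\<omega>. e \<omega> $ i) (normal_density 0 \<sigma>))"

text \<open>The maximum over nonzero \<open>x \<in> S\<close> of \<open>e\<^sup>T x / \<parallel>x\<parallel>\<^sub>2\<^sup>p\<close>, taken as a supremum
  in the extended reals. If \<open>S\<close> has no nonzero element, the maximum is 0 by convention.\<close>

definition max_ratio :: "real vec \<Rightarrow> real \<Rightarrow> nat \<Rightarrow> real vec set \<Rightarrow> ereal" where
  "max_ratio e p n S =
     (if S \<subseteq> {0\<^sub>v n} then 0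
      else (SUP x \<in> S - {0\<^sub>v n}. ereal (scalar_prod e x / l2_norm x powr p)))"

text \<open>\<open>X\<^sub>n = O\<^sub>P(a\<^sub>n)\<close>, where \<open>X\<^sub>n\<close> lives on its own probability space \<open>M n\<close>. Outer measure
  agrees with \<open>emeasure\<close> on measurable events; it is used because \<open>measure\<close> is 0
  on non-measurable ones. Where \<open>a\<^sub>n = 0\<close>, the event says \<open>X\<^sub>n \<noteq> 0\<close>.\<close>

definition bounded_in_prob ::
    "(nat \<Rightarrow> 'a measure) \<Rightarrow> (nat \<Rightarrow> 'a \<Rightarrow> ereal) \<Rightarrow> (nat \<Rightarrow> real) \<Rightarrow> bool" where
  "bounded_in_prob M X a \<longleftrightarrow>
     (\<forall>\<eta>>0. \<exists>C>0. \<forall>\<^sub>F n in sequentially.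
        outer_measure_of (M n) {\<omega> \<in> space (M n). \<bar>X n \<omega>\<bar> > ereal (C * a n)} \<le> ennreal \<eta>)"

definition lasso_objective :: "real mat \<Rightarrow> real \<Rightarrow> real vec \<Rightarrow> real vec \<Rightarrow> real" where
  "lasso_objective D l y b = 1/2 * (l2_norm (y - b))\<^sup>2 + l * l1_norm (D *\<^sub>v b)"

definition is_gen_lasso :: "nat \<Rightarrow> real mat \<Rightarrow> real \<Rightarrow> real vec \<Rightarrow> real vec \<Rightarrow> bool" where
  "is_gen_lasso n D l y b \<longleftrightarrow> is_arg_min (lasso_objective D l y) (\<lambda>b. b \<in> carrier_vec n) b"

end

theory Submission
  imports Defs
begin

text \<open>The supremum bound is obtained by Dudley chaining along dyadic nets at scales
  \<open>\<delta>\<^sub>k = \<rho> / 2\<^sup>k\<close>, where \<open>\<rho>\<close> is the radius of \<open>\<S>\<^sub>\<Delta>(1)\<close>. All nets contain the origin, so the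
  chain of a point of norm at most \<open>\<delta>\<^sub>j\<close> may start at \<open>0\<close> at level \<open>j\<close>; the remaining increments sum
  to a multiple of \<open>K \<delta>\<^sub>j powr (1 - w/2)\<close>, which gives the localized bound without a separate peeling
  step. Since \<open>\<S>\<^sub>\<Delta>(1)\<close> is symmetric, no ball of radius \<open>\<rho>/2\<close> covers it, so the entropy at scale
  \<open>\<rho>/2\<close> is at least \<open>ln 2\<close>; hence the exceptional probabilities are summable, uniformly in \<open>n\<close>.

  For the error rate, the basic inequality is combined with the splitting of the error into its
  projection onto the kernel of \<open>\<Delta>\<close>, where the noise has squared norm of order the nullity, and
  its row space part, where the supremum bound applies after rescaling by
  \<open>\<parallel>\<Delta>\<beta>\<^sub>0\<parallel>\<^sub>1 + \<parallel>\<Delta>\<beta>\<parallel>\<^sub>1\<close>, with \<open>\<beta>\<close> the estimate. Two applications of Young's inequality absorb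
  the remaining terms, and every constant in front of the tuning parameter works.\<close>

unbundle no inner_syntax and no vec_syntax

subsection \<open>Norms and orthogonal projections\<close>

lemma l2_norm_nonneg: "0 \<le> l2_norm v"
  by (simp add: l2_norm_def L2_set_nonneg)

lemma l2_norm_sq: "(l2_norm v)\<^sup>2 = v \<bullet> v"
  by (simp add: l2_norm_def L2_set_def sum_nonneg scalar_prod_def power2_eq_square lessThan_atLeast0)

lemma l2_norm_zero [simp]: "l2_norm (0\<^sub>v n) = 0"
  by (simp add: l2_norm_def L2_set_def)

lemma l2_norm_eq_0_iff:
  assumes "v \<in> carrier_vec n"
  shows "l2_norm v = 0 \<longleftrightarrow> v = 0\<^sub>v n"
proof
  assume "l2_norm v = 0"
  then have "\<forall>i<dim_vec v. v $ i = 0"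
    by (simp add: l2_norm_def L2_set_eq_0_iff)
  then show "v = 0\<^sub>v n" using assms by (intro eq_vecI) auto
qed simp

lemma l2_norm_smult: "l2_norm (c \<cdot>\<^sub>v v) = \<bar>c\<bar> * l2_norm v"
proof -
  have "(l2_norm (c \<cdot>\<^sub>v v))\<^sup>2 = (\<bar>c\<bar> * l2_norm v)\<^sup>2"
    unfolding power_mult_distrib l2_norm_sq by (simp add: power2_eq_square)
  then show ?thesis by (simp add: power2_eq_iff_nonneg l2_norm_nonneg)
qed

lemma l2_norm_triangle:
  assumes "a \<in> carrier_vec n" "b \<in> carrier_vec n"
  shows "l2_norm (a + b) \<le> l2_norm a + l2_norm b"
proof -
  have "l2_norm (a + b) = L2_set (\<lambda>i. a $ i + b $ i) {..<n}"
    using assms unfolding l2_norm_def by (intro L2_set_cong) auto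
  also have "\<dots> \<le> l2_norm a + l2_norm b"
    using L2_set_triangle_ineq[of "\<lambda>i. a $ i" "\<lambda>i. b $ i" "{..<n}"] assms by (simp add: l2_norm_def)
  finally show ?thesis .
qed

lemma l2_norm_minus_commute:
  assumes "a \<in> carrier_vec n" "b \<in> carrier_vec n"
  shows "l2_norm (a - b) = l2_norm (b - a)"
proof -
  have "a - b = (-1) \<cdot>\<^sub>v (b - a)" using assms by (intro eq_vecI) auto
  then show ?thesis by (simp add: l2_norm_smult)
qed

lemma l2_norm_triangle_diff:
  assumes "a \<in> carrier_vec n" "b \<in> carrier_vec n" "c \<in> carrier_vec n"
  shows "l2_norm (a - c) \<le> l2_norm (a - b) + l2_norm (b - c)"
proof -
  have "a - c = (a - b) + (b - c)" using assms by (intro eq_vecI) auto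
  then show ?thesis using l2_norm_triangle[of "a - b" n "b - c"] assms by auto
qed

lemma scalar_prod_le_l2_norm:
  assumes "a \<in> carrier_vec n" "b \<in> carrier_vec n"
  shows "\<bar>a \<bullet> b\<bar> \<le> l2_norm a * l2_norm b"
proof -
  have "\<bar>a \<bullet> b\<bar> \<le> (\<Sum>i<n. \<bar>a $ i\<bar> * \<bar>b $ i\<bar>)"
    using assms by (auto simp: scalar_prod_def lessThan_atLeast0 abs_mult[symmetric] intro: sum_abs)
  also have "\<dots> \<le> l2_norm a * l2_norm b"
    using L2_set_mult_ineq[of "\<lambda>i. a $ i" "\<lambda>i. b $ i" "{..<n}"] assms by (simp add: l2_norm_def)
  finally show ?thesis .
qed

lemma l1_norm_nonneg: "0 \<le> l1_norm v"
  by (simp add: l1_norm_def sum_nonneg)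

lemma l1_norm_smult: "l1_norm (c \<cdot>\<^sub>v v) = \<bar>c\<bar> * l1_norm v"
  by (simp add: l1_norm_def abs_mult sum_distrib_left)

lemma l1_norm_diff_le:
  assumes "a \<in> carrier_vec n" "b \<in> carrier_vec n"
  shows "l1_norm (a - b) \<le> l1_norm a + l1_norm b"
proof -
  have "l1_norm (a - b) = (\<Sum>i<n. \<bar>a $ i - b $ i\<bar>)"
    using assms by (auto simp: l1_norm_def)
  also have "\<dots> \<le> (\<Sum>i<n. \<bar>a $ i\<bar> + \<bar>b $ i\<bar>)" by (intro sum_mono) auto
  finally show ?thesis using assms by (simp add: l1_norm_def sum.distrib)
qed

lemma l1_norm_eq_0_iff:
  assumes "v \<in> carrier_vec n"
  shows "l1_norm v = 0 \<longleftrightarrow> v = 0\<^sub>v n"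
proof
  assume "l1_norm v = 0"
  then have "\<forall>i<dim_vec v. v $ i = 0"
    by (simp add: l1_norm_def sum_nonneg_eq_0_iff)
  then show "v = 0\<^sub>v n" using assms by (intro eq_vecI) auto
qed (simp add: l1_norm_def)

section \<open>Orthonormal systems and the splitting into kernel and row space\<close>

abbreviation vspan :: "nat \<Rightarrow> real vec set \<Rightarrow> real vec set" where
  "vspan n \<equiv> LinearCombinations.module.span class_ring (module_vec TYPE(real) n)"

text \<open>The orthogonal projection onto the span of \<open>U\<close> when \<open>U\<close> is
  orthonormal. The explicit coordinates make every inner product with it a finite sum over
  \<open>U\<close>.\<close>

definition orth_proj :: "nat \<Rightarrow> real vec set \<Rightarrow> real vec \<Rightarrow> real vec" where
  "orth_proj n U x = vec n (\<lambda>i. \<Sum>u\<in>U. (x \<bullet> u) * u $ i)"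

definition orthonormal_set :: "nat \<Rightarrow> real vec set \<Rightarrow> bool" where
  "orthonormal_set n U \<longleftrightarrow> finite U \<and> U \<subseteq> carrier_vec n \<and>
     (\<forall>u\<in>U. \<forall>v\<in>U. u \<bullet> v = (if u = v then 1 else 0))"

lemma orth_proj_carrier [simp]: "orth_proj n U x \<in> carrier_vec n"
  by (simp add: orth_proj_def)

lemma scalar_prod_orth_proj:
  assumes "U \<subseteq> carrier_vec n" "z \<in> carrier_vec n"
  shows "z \<bullet> orth_proj n U x = (\<Sum>u\<in>U. (x \<bullet> u) * (z \<bullet> u))"
proof -
  have "z \<bullet> orth_proj n U x = (\<Sum>i<n. \<Sum>u\<in>U. (x \<bullet> u) * (z $ i * u $ i))"
    using assms by (simp add: scalar_prod_def orth_proj_def lessThan_atLeast0 sum_distrib_left algebra_simps)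
  also have "\<dots> = (\<Sum>u\<in>U. \<Sum>i<n. (x \<bullet> u) * (z $ i * u $ i))" by (rule sum.swap)
  also have "\<dots> = (\<Sum>u\<in>U. (x \<bullet> u) * (z \<bullet> u))"
    using assms by (intro sum.cong refl) (auto simp: scalar_prod_def lessThan_atLeast0 sum_distrib_left)
  finally show ?thesis .
qed

lemma orth_proj_in_span:
  assumes "finite U" "U \<subseteq> carrier_vec n"
  shows "orth_proj n U x \<in> vspan n U"
proof -
  interpret vec_space "TYPE(real)" n .
  have "orth_proj n U x = lincomb (\<lambda>u. x \<bullet> u) U"
    using lincomb_closed[OF assms(2), of "\<lambda>u. x \<bullet> u"]
    by (intro eq_vecI) (simp_all add: orth_proj_def lincomb_index[OF _ assms(2)])
  then show ?thesis using assms unfolding span_def by auto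
qed

lemma orthonormal_residual:
  assumes U: "orthonormal_set n U" and x: "x \<in> carrier_vec n" and u: "u \<in> U"
  shows "(x - orth_proj n U x) \<bullet> u = 0"
proof -
  have uc: "u \<in> carrier_vec n" and Uc: "U \<subseteq> carrier_vec n" and "finite U"
    using U u by (auto simp: orthonormal_set_def)
  have "u \<bullet> orth_proj n U x = (\<Sum>v\<in>U. if v = u then x \<bullet> u else 0)"
    unfolding scalar_prod_orth_proj[OF Uc uc]
    using U u by (intro sum.cong) (auto simp: orthonormal_set_def)
  also have "\<dots> = x \<bullet> u" using u \<open>finite U\<close> by simp
  finally have "u \<bullet> orth_proj n U x = x \<bullet> u" .
  then show ?thesis
    using minus_scalar_prod_distrib[OF x orth_proj_carrier uc] comm_scalar_prod[OF uc orth_proj_carrier]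
    by simp
qed

text \<open>Gram-Schmidt by induction on \<open>W\<close>: the residual of the new vector is either
  zero, and \<open>U\<close> is kept, or it is normalised and adjoined. That \<open>U\<close> spans
  all of \<open>W\<close> is put in dual form, orthogonality to \<open>U\<close> implying
  orthogonality to \<open>W\<close>, which is how it is applied.\<close>

lemma orthonormal_set_exists:
  assumes "finite W" "W \<subseteq> carrier_vec n"
  shows "\<exists>U. orthonormal_set n U \<and> U \<subseteq> vspan n W \<and> card U \<le> card W \<and>
     (\<forall>z\<in>carrier_vec n. (\<forall>u\<in>U. z \<bullet> u = 0) \<longrightarrow> (\<forall>w\<in>W. z \<bullet> w = 0))"
  using assms
proof (induction W rule: finite_induct)
  case empty
  show ?case by (intro exI[of _ "{}"]) (auto simp: orthonormal_set_def)
next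
  case (insert w W)
  interpret vec_space "TYPE(real)" n .
  from insert obtain U where U: "orthonormal_set n U" "U \<subseteq> span W" "card U \<le> card W"
    and orth: "\<And>z v. z \<in> carrier_vec n \<Longrightarrow> \<forall>u\<in>U. z \<bullet> u = 0 \<Longrightarrow> v \<in> W \<Longrightarrow> z \<bullet> v = 0"
    by (auto 5 5)
  have Uc: "U \<subseteq> carrier_vec n" and fU: "finite U" using U by (auto simp: orthonormal_set_def)
  have w: "w \<in> carrier_vec n" and Wc: "W \<subseteq> carrier_vec n" using insert by auto
  define p where "p = orth_proj n U w"
  define q where "q = w - p"
  have p: "p \<in> carrier_vec n" and q: "q \<in> carrier_vec n" using w by (auto simp: p_def q_def)
  have wpq: "w = p + q" unfolding q_def using p w by (intro eq_vecI) auto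
  have pz: "z \<bullet> p = 0" if "z \<in> carrier_vec n" "\<forall>u\<in>U. z \<bullet> u = 0" for z
    unfolding p_def using scalar_prod_orth_proj[OF Uc that(1)] that(2) by simp
  have sub: "span W \<subseteq> span (insert w W)" by (rule span_is_monotone) auto
  have qU: "q \<bullet> u = 0" if "u \<in> U" for u
    unfolding q_def p_def by (rule orthonormal_residual[OF U(1) w that])
  show ?case
  proof (cases "q = 0\<^sub>v n")
    case True
    then have "w = p" using wpq p by simp
    have "card U \<le> card (insert w W)" using U(3) insert by simp
    moreover have "z \<bullet> v = 0" if "z \<in> carrier_vec n" "\<forall>u\<in>U. z \<bullet> u = 0" "v \<in> insert w W" for z v
      using pz[OF that(1,2)] orth[OF that(1,2)] that(3) \<open>w = p\<close> by (cases "v = w") simp_all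
    ultimately show ?thesis using U(1,2) sub by (intro exI[of _ U] conjI ballI impI) simp_all
  next
    case False
    define v where "v = (1 / l2_norm q) \<cdot>\<^sub>v q"
    have nq: "l2_norm q \<noteq> 0" using False l2_norm_eq_0_iff[OF q] by simp
    have v: "v \<in> carrier_vec n" using q by (simp add: v_def)
    have vv: "v \<bullet> v = 1"
      using nq l2_norm_nonneg[of q] by (simp add: l2_norm_sq[symmetric] v_def l2_norm_smult)
    have vU: "v \<bullet> u = 0" "u \<bullet> v = 0" if "u \<in> U" for u
    proof -
      show "v \<bullet> u = 0" using qU[OF that] q Uc that by (simp add: v_def subset_iff)
      then show "u \<bullet> v = 0" using comm_scalar_prod[of u n v] v Uc that by auto
    qed
    have on: "orthonormal_set n (insert v U)"
      using U(1) v vv vU by (auto simp: orthonormal_set_def)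
    have "p \<in> span U" unfolding p_def by (rule orth_proj_in_span[OF fU Uc])
    moreover have "span U \<subseteq> span W" using U(2) Wc by (intro span_subsetI)
    ultimately have ps: "p \<in> span (insert w W)" using sub by auto
    have ws: "w \<in> span (insert w W)" using in_own_span[of "insert w W"] w Wc by auto
    have "q = w + (-1) \<cdot>\<^sub>v p" unfolding q_def using w p by (intro eq_vecI) auto
    then have "q \<in> span (insert w W)"
      using span_add1[of "insert w W" w "(-1) \<cdot>\<^sub>v p"] smult_in_span[of "insert w W" p "-1"] ws ps w Wc by auto
    then have "v \<in> span (insert w W)"
      unfolding v_def using smult_in_span[of "insert w W"] w Wc by auto
    then have s: "insert v U \<subseteq> span (insert w W)" using U(2) sub by auto
    have "z \<bullet> w = 0" if z: "z \<in> carrier_vec n" "\<forall>u\<in>insert v U. z \<bullet> u = 0" for z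
    proof -
      have "z \<bullet> q = 0" using z nq q by (simp add: v_def)
      then show ?thesis using pz[OF z(1)] z by (simp add: wpq scalar_prod_add_distrib[OF z(1) p q])
    qed
    moreover have "card (insert v U) \<le> card (insert w W)"
      using U(3) insert fU by (simp add: card_insert_if)
    ultimately show ?thesis
      using on s orth by (intro exI[of _ "insert v U"] conjI ballI impI) (simp, simp, simp, elim insertE, simp_all)
  qed
qed

text \<open>Take \<open>U\<close> from a kernel basis and \<open>V\<close> from the rows. The
  residual \<open>R\<close> of \<open>d\<close> is orthogonal to the kernel. What \<open>V\<close>
  leaves of \<open>R\<close>, namely \<open>x\<close>, is orthogonal to all rows, hence in the
  kernel, hence orthogonal to \<open>R\<close>. As it is orthogonal to the \<open>V\<close> part of
  \<open>R\<close> too, it is orthogonal to itself and vanishes, so \<open>R\<close> lies in the row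
  space.\<close>

lemma kernel_row_space_decomposition:
  fixes D :: "real mat"
  assumes D: "D \<in> carrier_mat r n"
  obtains U where "orthonormal_set n U" "card U \<le> kernel_dim D"
    "\<And>d. d \<in> carrier_vec n \<Longrightarrow> d - orth_proj n U d \<in> vec_space.row_space n D"
    "\<And>d. d \<in> carrier_vec n \<Longrightarrow> D *\<^sub>v orth_proj n U d = 0\<^sub>v r"
proof -
  interpret kernel r n D by unfold_locales (rule D)
  obtain W where W: "finite W" "basis W"
    using kernel_basis_exists[OF D] by auto
  have Wker: "W \<subseteq> mat_kernel D" and "span W = mat_kernel D"
    using W by (auto simp: Ker.basis_def)
  then have spanW: "NC.span W = mat_kernel D" using span_same by auto
  have Wc: "W \<subseteq> carrier_vec n" using Wker mat_kernel_carrier[OF D] by auto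
  have cardW: "card W = kernel_dim D" using Ker.dim_basis[OF W] by simp
  obtain U where U: "orthonormal_set n U" "U \<subseteq> NC.span W" "card U \<le> card W"
    and Uorth: "\<And>z v. z \<in> carrier_vec n \<Longrightarrow> \<forall>u\<in>U. z \<bullet> u = 0 \<Longrightarrow> v \<in> W \<Longrightarrow> z \<bullet> v = 0"
    using orthonormal_set_exists[OF W(1) Wc] by auto
  have Rc: "set (rows D) \<subseteq> carrier_vec n" using D rows_carrier[of D] by auto
  obtain V where V: "orthonormal_set n V" "V \<subseteq> NC.span (set (rows D))"
    and Vorth: "\<And>z v. z \<in> carrier_vec n \<Longrightarrow> \<forall>u\<in>V. z \<bullet> u = 0 \<Longrightarrow> v \<in> set (rows D) \<Longrightarrow> z \<bullet> v = 0"
    using orthonormal_set_exists[OF _ Rc] by auto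
  have Uc: "U \<subseteq> carrier_vec n" "finite U" and Vc: "V \<subseteq> carrier_vec n" "finite V"
    using U V by (auto simp: orthonormal_set_def)
  have projU: "orth_proj n U d \<in> mat_kernel D" for d
  proof -
    have "NC.span U \<subseteq> NC.span W" using U(2) Wc by (intro NC.span_subsetI)
    then show ?thesis using orth_proj_in_span[of U n d] Uc spanW by auto
  qed
  have projV: "orth_proj n V d \<in> NC.row_space D" for d
  proof -
    have "NC.span V \<subseteq> NC.span (set (rows D))" using V(2) Rc by (intro NC.span_subsetI)
    then show ?thesis using orth_proj_in_span[of V n d] Vc unfolding NC.row_space_def by auto
  qed
  show thesis
  proof (rule that[OF U(1)])
    show "card U \<le> kernel_dim D" using U(3) cardW by simp
    fix d :: "real vec" assume d: "d \<in> carrier_vec n"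
    show "D *\<^sub>v orth_proj n U d = 0\<^sub>v r" using projU mat_kernelD[OF D] by auto
    define R where "R = d - orth_proj n U d"
    have R: "R \<in> carrier_vec n" using d by (simp add: R_def)
    define x where "x = R - orth_proj n V R"
    have x: "x \<in> carrier_vec n" using R by (simp add: x_def)
    have "\<forall>u\<in>U. R \<bullet> u = 0" unfolding R_def using orthonormal_residual[OF U(1) d] by auto
    then have "R \<in> NC.orthogonal_complement W"
      using Uorth[OF R] R by (auto simp: NC.orthogonal_complement_def)
    then have Rk: "R \<in> NC.orthogonal_complement (mat_kernel D)"
      using NC.in_orthogonal_complement_span[OF Wc] spanW by simp
    have xV: "\<forall>u\<in>V. x \<bullet> u = 0" unfolding x_def using orthonormal_residual[OF V(1) R] by auto
    have "D *\<^sub>v x = 0\<^sub>v r"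
    proof (rule eq_vecI)
      fix i assume i: "i < dim_vec (0\<^sub>v r)"
      then have "row D i \<in> set (rows D)" "row D i \<in> carrier_vec n" using D by (auto simp: rows_def)
      then show "(D *\<^sub>v x) $ i = 0\<^sub>v r $ i"
        using Vorth[OF x xV, of "row D i"] i D comm_scalar_prod[OF x, of "row D i"] by simp
    qed (use D in auto)
    then have "x \<in> mat_kernel D" by (intro mat_kernelI[OF D x])
    then have "x \<bullet> R = 0" using Rk comm_scalar_prod[OF x R] by (auto simp: NC.orthogonal_complement_def)
    moreover have "x \<bullet> orth_proj n V R = 0"
      using scalar_prod_orth_proj[OF Vc(1) x] xV by simp
    ultimately have "x \<bullet> x = 0"
      unfolding x_def[symmetric] using x_def scalar_prod_minus_distrib[OF x R orth_proj_carrier] by simp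
    then have "x = 0\<^sub>v n" using l2_norm_sq[of x] l2_norm_eq_0_iff[OF x] by simp
    have "R = orth_proj n V R"
    proof (rule eq_vecI)
      fix i assume "i < dim_vec (orth_proj n V R)"
      then have "x $ i = 0" "i < n" using \<open>x = 0\<^sub>v n\<close> by (simp_all add: orth_proj_def)
      then show "R $ i = orth_proj n V R $ i"
        using R orth_proj_carrier[of n V R] by (simp add: x_def)
    qed (use R in \<open>simp add: orth_proj_def\<close>)
    then show "d - orth_proj n U d \<in> NC.row_space D" using projV R_def by metis
  qed
qed

text \<open>Pythagoras gives Bessel's inequality and the contraction; Cauchy-Schwarz is then applied
  to the coordinates along \<open>U\<close>. Only these coordinates of the noise enter, so the
  kernel part costs the nullity and not the full dimension.\<close>

lemma scalar_prod_orth_proj_le: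
  assumes U: "orthonormal_set n U" and e: "e \<in> carrier_vec n" and d: "d \<in> carrier_vec n"
  shows "\<bar>e \<bullet> orth_proj n U d\<bar> \<le> sqrt (\<Sum>u\<in>U. (e \<bullet> u)\<^sup>2) * l2_norm d"
    and "l2_norm (d - orth_proj n U d) \<le> l2_norm d"
proof -
  have Uc: "U \<subseteq> carrier_vec n" "finite U" using U by (auto simp: orthonormal_set_def)
  let ?P = "orth_proj n U d"
  have dP: "d \<bullet> ?P = (\<Sum>u\<in>U. (d \<bullet> u)\<^sup>2)"
    using scalar_prod_orth_proj[OF Uc(1) d] by (simp add: power2_eq_square)
  have res: "(d - ?P) \<bullet> ?P = 0"
    using scalar_prod_orth_proj[OF Uc(1), of "d - ?P" d] d orthonormal_residual[OF U d] by simp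
  then have PP: "?P \<bullet> ?P = d \<bullet> ?P"
    using minus_scalar_prod_distrib[OF d orth_proj_carrier orth_proj_carrier] by simp
  have "(d - ?P) \<bullet> (d - ?P) = (d - ?P) \<bullet> d - (d - ?P) \<bullet> ?P"
    using d by (intro scalar_prod_minus_distrib) auto
  also have "\<dots> = d \<bullet> d - ?P \<bullet> ?P"
    using res PP minus_scalar_prod_distrib[OF d orth_proj_carrier d] comm_scalar_prod[OF d orth_proj_carrier]
    by simp
  finally have pyth: "(l2_norm (d - ?P))\<^sup>2 + (\<Sum>u\<in>U. (d \<bullet> u)\<^sup>2) = (l2_norm d)\<^sup>2"
    unfolding l2_norm_sq using dP PP by simp
  have s0: "0 \<le> (\<Sum>u\<in>U. (d \<bullet> u)\<^sup>2)" by (intro sum_nonneg) auto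
  show "l2_norm (d - ?P) \<le> l2_norm d"
    using pyth s0 by (intro power2_le_imp_le[OF _ l2_norm_nonneg]) linarith
  have "\<bar>e \<bullet> ?P\<bar> \<le> (\<Sum>u\<in>U. \<bar>e \<bullet> u\<bar> * \<bar>d \<bullet> u\<bar>)"
    unfolding scalar_prod_orth_proj[OF Uc(1) e]
    by (rule order_trans[OF sum_abs]) (simp add: abs_mult mult.commute)
  also have "\<dots> \<le> L2_set (\<lambda>u. e \<bullet> u) U * L2_set (\<lambda>u. d \<bullet> u) U" by (rule L2_set_mult_ineq)
  also have "\<dots> \<le> sqrt (\<Sum>u\<in>U. (e \<bullet> u)\<^sup>2) * l2_norm d"
  proof -
    have "sqrt (\<Sum>u\<in>U. (d \<bullet> u)\<^sup>2) \<le> l2_norm d"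
      using pyth l2_norm_nonneg[of d] zero_le_power2[of "l2_norm (d - ?P)"]
      by (intro real_le_lsqrt) linarith+
    then show ?thesis unfolding L2_set_def by (intro mult_left_mono) (auto intro: sum_nonneg)
  qed
  finally show "\<bar>e \<bullet> ?P\<bar> \<le> sqrt (\<Sum>u\<in>U. (e \<bullet> u)\<^sup>2) * l2_norm d" .
qed

subsection \<open>Gaussian tails\<close>

text \<open>Completing the square: exponential tilting shifts the mean to
  \<open>t * \<sigma>\<^sup>2\<close> and leaves the moment generating function as a factor.\<close>

lemma normal_density_exp:
  assumes "\<sigma> > 0"
  shows "normal_density 0 \<sigma> x * exp (t * x) = exp (\<sigma>\<^sup>2 * t\<^sup>2 / 2) * normal_density (t * \<sigma>\<^sup>2) \<sigma> x"
proof -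
  have "- x\<^sup>2 / (2 * \<sigma>\<^sup>2) + t * x = \<sigma>\<^sup>2 * t\<^sup>2 / 2 + - (x - t * \<sigma>\<^sup>2)\<^sup>2 / (2 * \<sigma>\<^sup>2)"
    using assms by (simp add: field_simps power2_eq_square)
  then have "exp (- x\<^sup>2 / (2 * \<sigma>\<^sup>2)) * exp (t * x) = exp (\<sigma>\<^sup>2 * t\<^sup>2 / 2) * exp (- (x - t * \<sigma>\<^sup>2)\<^sup>2 / (2 * \<sigma>\<^sup>2))"
    by (simp only: exp_add[symmetric])
  then show ?thesis by (simp add: normal_density_def)
qed

locale gaussian_vector = prob_space M for M :: "'a measure" +
  fixes n :: nat and \<sigma> :: real and e :: "'a \<Rightarrow> real vec"
  assumes sigma_pos: "\<sigma> > 0" and noise: "gaussian_noise M n \<sigma> e"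
begin

lemma e_carrier [simp]: "\<omega> \<in> space M \<Longrightarrow> e \<omega> \<in> carrier_vec n"
  using noise by (simp add: gaussian_noise_def)

lemma coord_distributed: "i < n \<Longrightarrow> distributed M lborel (\<lambda>\<omega>. e \<omega> $ i) (normal_density 0 \<sigma>)"
  using noise by (simp add: gaussian_noise_def)

lemma scalar_prod_noise_eq: "x \<in> carrier_vec n \<Longrightarrow> e \<omega> \<bullet> x = (\<Sum>i<n. e \<omega> $ i * x $ i)"
  by (simp add: scalar_prod_def lessThan_atLeast0)

lemma scalar_prod_measurable [measurable]:
  assumes "x \<in> carrier_vec n"
  shows "(\<lambda>\<omega>. e \<omega> \<bullet> x) \<in> borel_measurable M"
proof -
  have "(\<lambda>\<omega>. e \<omega> $ i) \<in> borel_measurable M" if "i < n" for i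
    using distributed_measurable[OF coord_distributed[OF that]] by simp
  then show ?thesis unfolding scalar_prod_noise_eq[OF assms] by measurable
qed

lemma exp_moment_coord:
  assumes "i < n"
  shows "integrable M (\<lambda>\<omega>. exp (e \<omega> $ i * t))"
    and "expectation (\<lambda>\<omega>. exp (e \<omega> $ i * t)) = exp (\<sigma>\<^sup>2 * t\<^sup>2 / 2)"
proof -
  have eq: "(\<lambda>x. normal_density 0 \<sigma> x * exp (x * t))
      = (\<lambda>x. exp (\<sigma>\<^sup>2 * t\<^sup>2 / 2) * normal_density (t * \<sigma>\<^sup>2) \<sigma> x)"
    using normal_density_exp[OF sigma_pos] by (simp add: mult.commute)
  have "integrable lborel (\<lambda>x. normal_density 0 \<sigma> x * exp (x * t))"
    unfolding eq using sigma_pos by simp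
  then show "integrable M (\<lambda>\<omega>. exp (e \<omega> $ i * t))"
    by (subst distributed_integrable[OF coord_distributed[OF assms], of "\<lambda>u. exp (u * t)", symmetric]) simp_all
  show "expectation (\<lambda>\<omega>. exp (e \<omega> $ i * t)) = exp (\<sigma>\<^sup>2 * t\<^sup>2 / 2)"
    using sigma_pos
    by (subst distributed_integral[OF coord_distributed[OF assms], symmetric]) (auto simp: eq)
qed

text \<open>Independence turns the exponential moment into a product over coordinates, and the
  exponents add up to the squared norm. The later tail and moment bounds rest on this formula; the
  law of \<open>e \<omega> \<bullet> x\<close> is never identified.\<close>

lemma exp_moment:
  assumes x: "x \<in> carrier_vec n"
  shows "integrable M (\<lambda>\<omega>. exp (e \<omega> \<bullet> x))"
    and "expectation (\<lambda>\<omega>. exp (e \<omega> \<bullet> x)) = exp (\<sigma>\<^sup>2 * (l2_norm x)\<^sup>2 / 2)"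
proof -
  have eq: "(\<lambda>\<omega>. exp (e \<omega> \<bullet> x)) = (\<lambda>\<omega>. \<Prod>i<n. exp (e \<omega> $ i * x $ i))"
    unfolding scalar_prod_noise_eq[OF x] by (simp add: exp_sum)
  have "indep_vars (\<lambda>_. borel) (\<lambda>i \<omega>. e \<omega> $ i) {..<n}"
    using noise by (simp add: gaussian_noise_def)
  then have ind: "indep_vars (\<lambda>_. borel) (\<lambda>i \<omega>. exp (e \<omega> $ i * x $ i)) {..<n}"
    by (rule indep_vars_compose2[where Y = "\<lambda>i u. exp (u * x $ i)"]) measurable
  have int: "integrable M (\<lambda>\<omega>. exp (e \<omega> $ i * x $ i))" if "i \<in> {..<n}" for i
    using exp_moment_coord that by auto
  show "integrable M (\<lambda>\<omega>. exp (e \<omega> \<bullet> x))"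
    unfolding eq by (rule indep_vars_integrable[OF _ ind int]) auto
  have "expectation (\<lambda>\<omega>. exp (e \<omega> \<bullet> x)) = (\<Prod>i<n. exp (\<sigma>\<^sup>2 * (x $ i)\<^sup>2 / 2))"
    unfolding eq by (subst indep_vars_lebesgue_integral[OF _ ind int]) (auto simp: exp_moment_coord)
  also have "\<dots> = exp (\<sigma>\<^sup>2 * (l2_norm x)\<^sup>2 / 2)"
    using x unfolding l2_norm_sq
    by (simp add: exp_sum[symmetric] scalar_prod_def lessThan_atLeast0
        sum_distrib_left sum_divide_distrib power2_eq_square)
  finally show "expectation (\<lambda>\<omega>. exp (e \<omega> \<bullet> x)) = exp (\<sigma>\<^sup>2 * (l2_norm x)\<^sup>2 / 2)" .
qed

lemma tail_bound_one_sided: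
  assumes x: "x \<in> carrier_vec n" and v: "l2_norm x \<le> v" "v > 0" and t: "t > 0"
  shows "prob {\<omega> \<in> space M. e \<omega> \<bullet> x \<ge> t} \<le> exp (- (t\<^sup>2 / (2 * \<sigma>\<^sup>2 * v\<^sup>2)))"
proof -
  \<comment> \<open>This \<open>s\<close> minimises the exponent
    \<open>\<sigma>\<^sup>2 * s\<^sup>2 * v\<^sup>2 / 2 - s * t\<close>.\<close>
  define s where "s = t / (\<sigma>\<^sup>2 * v\<^sup>2)"
  have s: "s > 0" using v t sigma_pos by (simp add: s_def)
  have sx: "s \<cdot>\<^sub>v x \<in> carrier_vec n" using x by simp
  have eq: "e \<omega> \<bullet> (s \<cdot>\<^sub>v x) = s * (e \<omega> \<bullet> x)" if "\<omega> \<in> space M" for \<omega>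
    using x e_carrier[OF that] by simp
  have "{\<omega> \<in> space M. e \<omega> \<bullet> x \<ge> t} = {\<omega> \<in> space M. exp (e \<omega> \<bullet> (s \<cdot>\<^sub>v x)) \<ge> exp (s * t)}"
    using s eq by auto
  then have "prob {\<omega> \<in> space M. e \<omega> \<bullet> x \<ge> t} \<le> expectation (\<lambda>\<omega>. exp (e \<omega> \<bullet> (s \<cdot>\<^sub>v x))) / exp (s * t)"
    using integral_Markov_inequality_measure[OF exp_moment(1)[OF sx], of "{}" "exp (s * t)"] by simp
  also have "\<dots> = exp (\<sigma>\<^sup>2 * s\<^sup>2 * (l2_norm x)\<^sup>2 / 2 - s * t)"
    using s by (simp add: exp_moment(2)[OF sx] l2_norm_smult exp_diff power_mult_distrib mult.assoc)
  also have "\<dots> \<le> exp (\<sigma>\<^sup>2 * s\<^sup>2 * v\<^sup>2 / 2 - s * t)"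
    using v by (auto intro!: mult_left_mono power_mono simp: l2_norm_nonneg)
  also have "\<sigma>\<^sup>2 * s\<^sup>2 * v\<^sup>2 / 2 - s * t = - (t\<^sup>2 / (2 * \<sigma>\<^sup>2 * v\<^sup>2))"
    using sigma_pos v by (simp add: s_def field_simps power2_eq_square)
  finally show ?thesis .
qed

lemma tail_bound:
  assumes x: "x \<in> carrier_vec n" and v: "l2_norm x \<le> v" "v > 0" and t: "t > 0"
  shows "prob {\<omega> \<in> space M. \<bar>e \<omega> \<bullet> x\<bar> \<ge> t} \<le> 2 * exp (- (t\<^sup>2 / (2 * \<sigma>\<^sup>2 * v\<^sup>2)))"
proof -
  have mx: "-x \<in> carrier_vec n" using x by simp
  have nx: "l2_norm (-x) = l2_norm x"
    by (simp add: l2_norm_def L2_set_def)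
  have "{\<omega> \<in> space M. \<bar>e \<omega> \<bullet> x\<bar> \<ge> t}
      = {\<omega> \<in> space M. e \<omega> \<bullet> x \<ge> t} \<union> {\<omega> \<in> space M. e \<omega> \<bullet> (-x) \<ge> t}"
    using x by (auto simp: scalar_prod_uminus_right[of _ x] carrier_vecD[OF e_carrier])
  also have "prob \<dots> \<le> prob {\<omega> \<in> space M. e \<omega> \<bullet> x \<ge> t} + prob {\<omega> \<in> space M. e \<omega> \<bullet> (-x) \<ge> t}"
    using x mx by (intro measure_Un_le) measurable
  finally show ?thesis
    using tail_bound_one_sided[OF x v t] tail_bound_one_sided[OF mx _ v(2) t] v(1) nx by simp
qed

text \<open>Any bound free of \<open>n\<close> and \<open>x\<close> serves. This one follows from
  the exponential moments through \<open>u\<^sup>2 \<le> 2 * (exp u + exp (-u))\<close>.\<close>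

lemma expectation_square_le:
  assumes x: "x \<in> carrier_vec n" and "l2_norm x = 1"
  shows "integrable M (\<lambda>\<omega>. (e \<omega> \<bullet> x)\<^sup>2)"
    and "expectation (\<lambda>\<omega>. (e \<omega> \<bullet> x)\<^sup>2) \<le> 4 * exp (\<sigma>\<^sup>2 / 2)"
proof -
  have mx: "-x \<in> carrier_vec n" using x by simp
  have nx: "l2_norm (-x) = l2_norm x"
    by (simp add: l2_norm_def L2_set_def)
  let ?g = "\<lambda>\<omega>. 2 * (exp (e \<omega> \<bullet> x) + exp (e \<omega> \<bullet> (-x)))"
  have pos: "u\<^sup>2 \<le> 2 * (exp u + exp (-u))" for u :: real
  proof -
    have "u\<^sup>2 \<le> 2 * exp u" if "u \<ge> 0" for u :: real
      using exp_lower_Taylor_quadratic[OF that] that by simp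
    from this[of u] this[of "-u"] show ?thesis
      by (cases "u \<ge> 0") (auto simp: distrib_left intro: add_increasing add_increasing2)
  qed
  have int: "integrable M ?g" using exp_moment(1)[OF x] exp_moment(1)[OF mx] by simp
  have le: "(e \<omega> \<bullet> x)\<^sup>2 \<le> ?g \<omega>" if "\<omega> \<in> space M" for \<omega>
    using pos[of "e \<omega> \<bullet> x"] x e_carrier[OF that] by simp
  show *: "integrable M (\<lambda>\<omega>. (e \<omega> \<bullet> x)\<^sup>2)"
    using x le by (intro Bochner_Integration.integrable_bound[OF int]) (auto intro!: AE_I2 intro: order_trans[OF _ abs_ge_self])
  have "expectation (\<lambda>\<omega>. (e \<omega> \<bullet> x)\<^sup>2) \<le> expectation ?g"
    using le by (intro integral_mono[OF * int])
  also have "\<dots> = 4 * exp (\<sigma>\<^sup>2 / 2)"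
    using exp_moment[OF x] exp_moment[OF mx] assms nx by simp
  finally show "expectation (\<lambda>\<omega>. (e \<omega> \<bullet> x)\<^sup>2) \<le> 4 * exp (\<sigma>\<^sup>2 / 2)" .
qed

text \<open>Markov's inequality for a sum of at most \<open>N\<close> second moments. Allowing
  \<open>N\<close> to exceed \<open>card U\<close> lets the nullity take its place.\<close>

lemma sum_square_tail:
  assumes U: "orthonormal_set n U" and "card U \<le> N" and C: "(C::real) > 0"
  shows "{\<omega> \<in> space M. (\<Sum>u\<in>U. (e \<omega> \<bullet> u)\<^sup>2) > C * real N} \<in> events"
    and "prob {\<omega> \<in> space M. (\<Sum>u\<in>U. (e \<omega> \<bullet> u)\<^sup>2) > C * real N} \<le> 4 * exp (\<sigma>\<^sup>2 / 2) / C"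
proof -
  have Uc: "finite U" "U \<subseteq> carrier_vec n" and unit: "\<And>u. u \<in> U \<Longrightarrow> (l2_norm u)\<^sup>2 = 1"
    using U unfolding l2_norm_sq by (auto simp: orthonormal_set_def)
  have unit: "l2_norm u = 1" if "u \<in> U" for u
    using unit[OF that] l2_norm_nonneg[of u] by (simp add: power2_eq_1_iff)
  let ?X = "\<lambda>\<omega>. \<Sum>u\<in>U. (e \<omega> \<bullet> u)\<^sup>2"
  have [measurable]: "(\<lambda>\<omega>. e \<omega> \<bullet> u) \<in> borel_measurable M" if "u \<in> U" for u
    using Uc that by auto
  have [measurable]: "?X \<in> borel_measurable M" by (intro borel_measurable_sum) measurable
  show "{\<omega> \<in> space M. ?X \<omega> > C * real N} \<in> events" by measurable
  show "prob {\<omega> \<in> space M. ?X \<omega> > C * real N} \<le> 4 * exp (\<sigma>\<^sup>2 / 2) / C"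
  proof (cases "N = 0")
    \<comment> \<open>Markov's inequality would divide by zero here; but \<open>U\<close> is empty,
      so the sum is zero and the strict event is empty.\<close>
    case True
    then show ?thesis using assms Uc C by simp
  next
    case False
    have int: "integrable M ?X" using Uc unit expectation_square_le(1) by (intro Bochner_Integration.integrable_sum) auto
    have "prob {\<omega> \<in> space M. ?X \<omega> > C * real N} \<le> prob {\<omega> \<in> space M. ?X \<omega> \<ge> C * real N}"
      by (intro finite_measure_mono) (auto, measurable)
    also have "\<dots> \<le> expectation ?X / (C * real N)"
      using C False by (intro integral_Markov_inequality_measure[OF int, of "{}"]) (auto intro!: sum_nonneg AE_I2)
    also have "expectation ?X = (\<Sum>u\<in>U. expectation (\<lambda>\<omega>. (e \<omega> \<bullet> u)\<^sup>2))"
      using Uc unit expectation_square_le(1) by (intro Bochner_Integration.integral_sum) auto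
    also have "\<dots> \<le> (\<Sum>u\<in>U. 4 * exp (\<sigma>\<^sup>2 / 2))"
      using Uc unit expectation_square_le(2) by (intro sum_mono) auto
    also have "\<dots> \<le> real N * (4 * exp (\<sigma>\<^sup>2 / 2))"
      using assms by simp
    finally show ?thesis using C False by (simp add: field_simps divide_right_mono)
  qed
qed

end

subsection \<open>Chaining\<close>

text \<open>Deterministic: \<open>e\<close> is one realisation of the noise that obeys the increment
  bounds \<open>incr\<close>. The point \<open>x\<close> is approached by links between nets of
  consecutive levels, and the part not yet reached has norm at most \<open>\<delta> (j + m)\<close>,
  so by Cauchy-Schwarz it contributes nothing in the limit.\<close>

lemma chaining_bound:
  fixes \<delta> t :: "nat \<Rightarrow> real"
  assumes e: "e \<in> carrier_vec n" and x: "x \<in> carrier_vec n"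
    and C: "\<And>k. C k \<subseteq> carrier_vec n" "\<And>k. 0\<^sub>v n \<in> C k"
    and net: "\<And>k. \<exists>c\<in>C k. l2_norm (x - c) \<le> \<delta> k"
    and dec: "\<And>k. \<delta> (Suc k) \<le> \<delta> k" and lim: "\<delta> \<longlonglongrightarrow> 0"
    and incr: "\<And>k a b. a \<in> C k \<Longrightarrow> b \<in> C (Suc k) \<Longrightarrow> l2_norm (b - a) \<le> 2 * \<delta> k \<Longrightarrow> \<bar>e \<bullet> (b - a)\<bar> \<le> t k"
    and t: "\<And>k. 0 \<le> t k" "summable (\<lambda>k. t (j + k))"
    and xj: "l2_norm x \<le> \<delta> j"
  shows "\<bar>e \<bullet> x\<bar> \<le> (\<Sum>k. t (j + k))"
proof -
  obtain p where p: "\<And>k. p k \<in> C k" "\<And>k. l2_norm (x - p k) \<le> \<delta> k"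
    using net by metis
  \<comment> \<open>The chain starts at the origin instead of the net point \<open>p j\<close>,
    which is admissible because \<open>xj\<close> puts \<open>x\<close> within
    \<open>\<delta> j\<close> of it. Thus no link coarser than level \<open>j\<close> is paid
    for.\<close>
  define q where "q m = (if m = 0 then 0\<^sub>v n else p (j + m))" for m
  have qC: "q m \<in> C (j + m)" for m using p C by (simp add: q_def)
  have qc: "q m \<in> carrier_vec n" for m using qC C by blast
  have q: "l2_norm (x - q m) \<le> \<delta> (j + m)" for m
    using p xj x by (simp add: q_def)
  have step: "\<bar>e \<bullet> q m\<bar> \<le> (\<Sum>k<m. t (j + k))" for m
  proof (induction m)
    case 0
    show ?case using e by (simp add: q_def)
  next
    case (Suc m)
    \<comment> \<open>A link is at most \<open>\<delta> (j + m) + \<delta> (j + Suc m)\<close> long,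
      whence the factor 2 in \<open>incr\<close>.\<close>
    have "l2_norm (q (Suc m) - q m) \<le> l2_norm (q (Suc m) - x) + l2_norm (x - q m)"
      by (rule l2_norm_triangle_diff[OF qc x qc])
    also have "\<dots> \<le> 2 * \<delta> (j + m)"
      using q[of m] q[of "Suc m"] dec[of "j + m"] l2_norm_minus_commute[OF x qc, of "Suc m"] by simp
    finally have "\<bar>e \<bullet> (q (Suc m) - q m)\<bar> \<le> t (j + m)"
      using incr[OF qC[of m], of "q (Suc m)"] qC[of "Suc m"] by simp
    moreover have "e \<bullet> (q (Suc m) - q m) = e \<bullet> q (Suc m) - e \<bullet> q m"
      by (rule scalar_prod_minus_distrib[OF e qc qc])
    ultimately show ?case using Suc by simp
  qed
  have "\<bar>e \<bullet> x\<bar> \<le> (\<Sum>k. t (j + k)) + l2_norm e * \<delta> (j + m)" for m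
  proof -
    have "e \<bullet> x = e \<bullet> q m + e \<bullet> (x - q m)"
      using scalar_prod_minus_distrib[OF e x qc] by simp
    moreover have "\<bar>e \<bullet> (x - q m)\<bar> \<le> l2_norm e * l2_norm (x - q m)"
      using e x qc by (intro scalar_prod_le_l2_norm) auto
    moreover have "l2_norm e * l2_norm (x - q m) \<le> l2_norm e * \<delta> (j + m)"
      using q by (intro mult_left_mono l2_norm_nonneg)
    moreover have "(\<Sum>k<m. t (j + k)) \<le> (\<Sum>k. t (j + k))"
      using t by (intro sum_le_suminf) auto
    ultimately show ?thesis using step[of m] by linarith
  qed
  moreover have "(\<lambda>m. (\<Sum>k. t (j + k)) + l2_norm e * \<delta> (j + m)) \<longlonglongrightarrow> (\<Sum>k. t (j + k)) + l2_norm e * 0"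
    using LIMSEQ_ignore_initial_segment[OF lim, of j]
    by (intro tendsto_intros) (simp add: add.commute)
  ultimately show ?thesis
    by (intro LIMSEQ_le_const[of _ _ "\<bar>e \<bullet> x\<bar>"]) auto
qed

text \<open>Here \<open>\<rho>\<close> is the supremum of the norms over \<open>S\<close>, finite
  because finitely many unit balls cover \<open>S\<close>. A point of norm above
  \<open>\<rho> / 2\<close> and its negative are more than \<open>\<rho>\<close> apart, so a cover
  of radius \<open>\<rho> / 2\<close> has at least two centres.\<close>

lemma entropy_radius:
  fixes A w :: real
  assumes S: "S \<subseteq> carrier_vec n" "\<And>x. x \<in> S \<Longrightarrow> -x \<in> S" "x\<^sub>0 \<in> S" "x\<^sub>0 \<noteq> 0\<^sub>v n"
    and cover: "\<And>\<delta>. \<delta> > 0 \<Longrightarrow> \<exists>C. finite C \<and> C \<subseteq> carrier_vec n \<and> S \<subseteq> (\<Union>c\<in>C. l2_ball n c \<delta>)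
        \<and> real (card C) \<le> exp (h \<delta>)"
  obtains \<rho> where "\<rho> > 0" "\<And>x. x \<in> S \<Longrightarrow> l2_norm x \<le> \<rho>" "ln 2 \<le> h (\<rho> / 2)"
proof -
  obtain C where C: "finite C" "C \<subseteq> carrier_vec n" "S \<subseteq> (\<Union>c\<in>C. l2_ball n c 1)"
    using cover[of 1] by auto
  have "l2_norm x \<le> 1 + (\<Sum>c\<in>C. l2_norm c)" if x: "x \<in> S" for x
  proof -
    obtain c where c: "c \<in> C" "l2_norm (x - c) \<le> 1" using C x by (auto simp: l2_ball_def)
    have xc: "x \<in> carrier_vec n" "c \<in> carrier_vec n" using x S C c by auto
    have "x = (x - c) + c" using xc by (intro eq_vecI) auto
    then have "l2_norm x \<le> l2_norm (x - c) + l2_norm c"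
      using l2_norm_triangle[of "x - c" n c] xc by auto
    moreover have "l2_norm c \<le> (\<Sum>c\<in>C. l2_norm c)"
      using C c by (intro member_le_sum) (auto simp: l2_norm_nonneg)
    ultimately show ?thesis using c by simp
  qed
  then have bdd: "bdd_above (l2_norm ` S)" by (intro bdd_aboveI2)
  define \<rho> where "\<rho> = Sup (l2_norm ` S)"
  have le: "l2_norm x \<le> \<rho>" if "x \<in> S" for x
    unfolding \<rho>_def using that bdd by (rule cSUP_upper)
  have "l2_norm x\<^sub>0 > 0"
    using l2_norm_eq_0_iff[of x\<^sub>0 n] S l2_norm_nonneg[of x\<^sub>0] by (auto simp: less_le)
  then have \<rho>: "\<rho> > 0" using le[OF S(3)] by simp
  then obtain x where x: "x \<in> S" "\<rho> / 2 < l2_norm x"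
    using less_cSup_iff[of "l2_norm ` S" "\<rho> / 2"] bdd S(3) unfolding \<rho>_def by auto
  obtain C where C: "finite C" "C \<subseteq> carrier_vec n" "S \<subseteq> (\<Union>c\<in>C. l2_ball n c (\<rho> / 2))"
    "real (card C) \<le> exp (h (\<rho> / 2))"
    using cover[of "\<rho> / 2"] \<rho> by auto
  obtain a b where ab: "a \<in> C" "l2_norm (x - a) \<le> \<rho> / 2" "b \<in> C" "l2_norm (-x - b) \<le> \<rho> / 2"
    using subsetD[OF C(3) x(1)] subsetD[OF C(3) S(2)[OF x(1)]] by (auto simp: l2_ball_def)
  have xc: "x \<in> carrier_vec n" and ac: "a \<in> carrier_vec n" and bc: "b \<in> carrier_vec n" using x ab C S by auto
  have "a \<noteq> b"
  proof
    assume eq: "a = b"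
    have "l2_norm (x - (-x)) \<le> l2_norm (x - a) + l2_norm (a - (-x))"
      using xc ac by (intro l2_norm_triangle_diff) auto
    also have "\<dots> \<le> \<rho>" using ab eq l2_norm_minus_commute[of a n "-x"] xc ac by simp
    also have "x - (-x) = 2 \<cdot>\<^sub>v x" using xc by (intro eq_vecI) auto
    finally show False using x by (simp add: l2_norm_smult)
  qed
  then have "2 \<le> card C" using card_mono[OF C(1), of "{a, b}"] ab by simp
  then have "2 \<le> exp (h (\<rho> / 2))" using C(4) by simp
  then have "ln 2 \<le> h (\<rho> / 2)" by (metis exp_gt_zero ln_exp ln_le_cancel_iff zero_less_numeral)
  then show thesis using that \<rho> le by blast
qed

text \<open>Level \<open>k\<close> has at most \<open>4 * exp (2 * H (Suc k))\<close> links, and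
  each exceeds \<open>t k\<close> with probability at most
  \<open>2 * exp (- ((a + 2) * H (Suc k)))\<close>. The union bound leaves
  \<open>8 * exp (- (a * H (Suc k)))\<close>, which is summable. Hence \<open>a\<close> makes the
  exceptional event as rare as desired, at the price of a factor
  \<open>sqrt (a + 2)\<close>.\<close>

lemma (in gaussian_vector) gaussian_sup_bound:
  fixes A w a :: real and S :: "real vec set"
  assumes S: "S \<subseteq> carrier_vec n" "\<And>x. x \<in> S \<Longrightarrow> -x \<in> S" "x\<^sub>0 \<in> S" "x\<^sub>0 \<noteq> 0\<^sub>v n"
    and cover: "\<And>\<delta>. \<delta> > 0 \<Longrightarrow> \<exists>C. finite C \<and> C \<subseteq> carrier_vec n \<and> S \<subseteq> (\<Union>c\<in>C. l2_ball n c \<delta>)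
        \<and> real (card C) \<le> exp (A * \<delta> powr (-w))"
    and w: "0 < w" "w < 2" and a: "a > 0"
  shows "\<exists>Bad\<in>events. prob Bad \<le> 16 / (a * (1 - 2 powr (-w))) \<and>
      (\<forall>\<omega>\<in>space M - Bad. \<forall>x\<in>S. \<bar>e \<omega> \<bullet> x\<bar>
         \<le> 2 * sqrt (8 * \<sigma>\<^sup>2 * (a + 2)) / (1 - (1/2) powr (1 - w/2)) * sqrt A * l2_norm x powr (1 - w/2))"
proof -
  obtain \<rho> where \<rho>: "\<rho> > 0" "\<And>x. x \<in> S \<Longrightarrow> l2_norm x \<le> \<rho>" and h1: "ln 2 \<le> A * (\<rho> / 2) powr (-w)"
    using entropy_radius[OF S cover] by blast
  define \<theta> where "\<theta> = 1 - w/2"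
  have \<theta>: "0 < \<theta>" "\<theta> < 1" using w by (auto simp: \<theta>_def)
  \<comment> \<open>Chosen so that in \<open>t_sq\<close> the Chernoff exponent of a link of length
    \<open>2 * \<delta> k\<close> is exactly \<open>(a + 2) * H (Suc k)\<close>; the 8 is
    \<open>2 * 2\<^sup>2\<close>.\<close>
  define B where "B = sqrt (8 * \<sigma>\<^sup>2 * (a + 2))"
  have B: "B > 0" using a sigma_pos by (simp add: B_def)
  have A: "A > 0"
  proof -
    have "0 < A * (\<rho> / 2) powr (-w)" using h1 ln_gt_zero[of 2] by linarith
    then show ?thesis using \<rho> by (simp add: zero_less_mult_iff)
  qed
  define \<delta> where "\<delta> k = \<rho> * (1/2) ^ k" for k :: nat
  have \<delta>: "\<delta> k > 0" for k using \<rho> by (simp add: \<delta>_def)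
  have \<delta>_Suc: "\<delta> (Suc k) = \<delta> k / 2" for k by (simp add: \<delta>_def)
  define H where "H k = A * \<delta> k powr (-w)" for k
  have H_Suc: "H (Suc k) = H k * 2 powr w" for k
    using \<delta>[of k] by (simp add: H_def \<delta>_Suc powr_divide powr_minus field_simps)
  have H_pos: "H k > 0" for k using A \<delta>[of k] by (simp add: H_def)
  have H_mono: "H k \<le> H (Suc k)" for k
    unfolding H_Suc using H_pos[of k] w ge_one_powr_ge_zero[of 2 w] by simp
  \<comment> \<open>The entropy grows by the factor \<open>2 powr w\<close> per level, starting from
    level 1, whose scale is \<open>\<rho> / 2\<close>. Hence the index \<open>Suc k\<close>, and the
    constant \<open>1/2\<close>, which lies below \<open>ln 2\<close>.\<close>
  have H_ge: "H (Suc k) \<ge> (1/2) * (2 powr w) ^ k" for k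
  proof (induction k)
    case 0
    have "(1/2::real) \<le> ln 2" using ln2_ge_two_thirds by simp
    then show ?case using h1 by (simp add: H_def \<delta>_def)
  next
    case (Suc k)
    then show ?case using H_Suc[of "Suc k"] mult_right_mono[OF Suc, of "2 powr w"] by (simp add: mult.commute mult.left_commute)
  qed
  have "\<forall>k. \<exists>C. finite C \<and> C \<subseteq> carrier_vec n \<and> S \<subseteq> (\<Union>c\<in>C. l2_ball n c (\<delta> k)) \<and> real (card C) \<le> exp (H k)"
    using cover[OF \<delta>] by (simp add: H_def)
  then obtain C0 where C0: "\<And>k. finite (C0 k)" "\<And>k. C0 k \<subseteq> carrier_vec n"
    "\<And>k. S \<subseteq> (\<Union>c\<in>C0 k. l2_ball n c (\<delta> k))" "\<And>k. real (card (C0 k)) \<le> exp (H k)"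
    by metis
  \<comment> \<open>Adjoining the origin lets a chain start at any level and costs the factor 2 in
    \<open>cardC\<close>.\<close>
  define C where "C k = insert (0\<^sub>v n) (C0 k)" for k
  have C: "finite (C k)" "C k \<subseteq> carrier_vec n" "0\<^sub>v n \<in> C k" for k
    using C0 by (auto simp: C_def)
  have cardC: "real (card (C k)) \<le> 2 * exp (H k)" for k
  proof -
    have "card (C k) \<le> Suc (card (C0 k))" unfolding C_def by (rule card_insert_le_m1) auto
    then have "real (card (C k)) \<le> 1 + exp (H k)" using C0(4)[of k] by linarith
    then show ?thesis using one_le_exp_iff[of "H k"] H_pos[of k] by linarith
  qed
  have net: "\<exists>c\<in>C k. l2_norm (x - c) \<le> \<delta> k" if "x \<in> S" for x k
    using C0(3)[of k] that by (auto simp: C_def l2_ball_def)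
  define t where "t k = B * sqrt A * 2 powr (w/2) * \<delta> k powr \<theta>" for k
    \<comment> \<open>equals \<open>B * \<delta> k * sqrt (H (Suc k))\<close>, the Gaussian scale of a maximum over \<open>exp (2 * H (Suc k))\<close> increments\<close>
  have t_pos: "t k > 0" for k using B A \<delta>[of k] by (simp add: t_def)
  have t_sq: "(t k)\<^sup>2 / (2 * \<sigma>\<^sup>2 * (2 * \<delta> k)\<^sup>2) = (a + 2) * H (Suc k)" for k
  proof -
    have 2: "(2 powr (w/2))\<^sup>2 = (2::real) powr w"
      by (simp add: power2_eq_square powr_add[symmetric])
    have "(\<delta> k powr \<theta>)\<^sup>2 = \<delta> k powr (2 + (-w))"
      by (simp add: power2_eq_square powr_add[symmetric] \<theta>_def)
    also have "\<dots> = (\<delta> k)\<^sup>2 * \<delta> k powr (-w)"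
      using \<delta>[of k] by (simp only: powr_add powr_numeral)
    finally have \<delta>2: "(\<delta> k powr \<theta>)\<^sup>2 = (\<delta> k)\<^sup>2 * \<delta> k powr (-w)" .
    have B2: "B\<^sup>2 = 8 * \<sigma>\<^sup>2 * (a + 2)" using a by (simp add: B_def)
    have "(t k)\<^sup>2 = 8 * \<sigma>\<^sup>2 * (a + 2) * A * 2 powr w * ((\<delta> k)\<^sup>2 * \<delta> k powr (-w))"
      unfolding t_def power_mult_distrib 2 \<delta>2 B2 using A by simp
    also have "\<dots> = (a + 2) * H (Suc k) * (2 * \<sigma>\<^sup>2 * (2 * \<delta> k)\<^sup>2)"
      unfolding H_Suc unfolding H_def by (simp add: power2_eq_square algebra_simps)
    finally show ?thesis
      using \<delta>[of k] sigma_pos by simp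
  qed
  \<comment> \<open>Only short pairs are collected: the chain uses no others, and their length is
    what the tail bound at threshold \<open>t k\<close> relies on.\<close>
  define I where "I k = {(c, d). c \<in> C k \<and> d \<in> C (Suc k) \<and> l2_norm (d - c) \<le> 2 * \<delta> k}" for k
  have I_sub: "I k \<subseteq> C k \<times> C (Suc k)" for k by (auto simp: I_def)
  have I_fin: "finite (I k)" for k using finite_subset[OF I_sub] C by blast
  have I_card: "real (card (I k)) \<le> 4 * exp (2 * H (Suc k))" for k
  proof -
    have "card (I k) \<le> card (C k) * card (C (Suc k))"
      using card_mono[OF _ I_sub, of k] C by (simp add: card_cartesian_product)
    then have "real (card (I k)) \<le> real (card (C k)) * real (card (C (Suc k)))"
      by (metis of_nat_le_iff of_nat_mult)
    also have "\<dots> \<le> (2 * exp (H (Suc k))) * (2 * exp (H (Suc k)))"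
    proof (rule mult_mono)
      show "real (card (C k)) \<le> 2 * exp (H (Suc k))"
        using cardC[of k] exp_le_cancel_iff[of "H k" "H (Suc k)"] H_mono[of k] by linarith
    qed (use cardC in auto)
    also have "\<dots> = 4 * exp (2 * H (Suc k))" by (simp add: exp_double power2_eq_square)
    finally show ?thesis .
  qed
  define Ev where "Ev p k = {\<omega> \<in> space M. \<bar>e \<omega> \<bullet> (snd p - fst p)\<bar> \<ge> t k}" for p k
  define Bk where "Bk k = (\<Union>p\<in>I k. Ev p k)" for k
  have I_carrier: "snd p - fst p \<in> carrier_vec n" "l2_norm (snd p - fst p) \<le> 2 * \<delta> k" if "p \<in> I k" for p k
    using that C(2)[of k] C(2)[of "Suc k"] by (auto simp: I_def intro!: minus_carrier_vec)
  have Ev: "Ev p k \<in> events" if "p \<in> I k" for p k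
    unfolding Ev_def using scalar_prod_measurable[OF I_carrier(1)[OF that]] by measurable
  have Bk: "Bk k \<in> events" for k unfolding Bk_def using I_fin Ev by (intro sets.finite_UN) auto
  have Bk_prob: "prob (Bk k) \<le> 16 / a * (2 powr (-w)) ^ k" for k
  proof -
    have "prob (Bk k) \<le> (\<Sum>p\<in>I k. prob (Ev p k))"
      unfolding Bk_def using I_fin Ev by (intro finite_measure_subadditive_finite) auto
    also have "\<dots> \<le> (\<Sum>p\<in>I k. 2 * exp (- ((a + 2) * H (Suc k))))"
      unfolding Ev_def t_sq[symmetric]
      using I_carrier t_pos \<delta> by (intro sum_mono tail_bound) auto
    also have "\<dots> = real (card (I k)) * (2 * exp (- ((a + 2) * H (Suc k))))" by simp
    also have "\<dots> \<le> 4 * exp (2 * H (Suc k)) * (2 * exp (- ((a + 2) * H (Suc k))))"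
      using I_card by (intro mult_right_mono) auto
    also have "\<dots> = 8 * exp (- (a * H (Suc k)))"
      by (simp add: exp_add[symmetric] algebra_simps)
    \<comment> \<open>From \<open>exp (- u) \<le> 1 / u\<close>. Together with \<open>H_ge\<close>
      this yields a geometric series whose sum is free of \<open>A\<close>, \<open>\<rho>\<close>
      and \<open>n\<close>.\<close>
    also have "\<dots> \<le> 8 * (1 / (a * H (Suc k)))"
    proof -
      have "a * H (Suc k) \<le> exp (a * H (Suc k))" using exp_ge_add_one_self[of "a * H (Suc k)"] by linarith
      then show ?thesis using a H_pos[of "Suc k"] by (simp add: exp_minus field_simps)
    qed
    also have "\<dots> \<le> 8 * (1 / (a * ((1/2) * (2 powr w) ^ k)))"
      using a H_ge[of k] by (intro mult_left_mono divide_left_mono mult_pos_pos) (auto simp: H_pos)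
    also have "\<dots> = 16 / a * (2 powr (-w)) ^ k"
      by (simp add: powr_minus power_inverse field_simps)
    finally show ?thesis .
  qed
  define r where "r = 2 powr (-w)"
  have r: "0 < r" "r < 1" using w powr_less_mono[of "-w" 0 2] by (auto simp: r_def)
  have r_sums: "(\<lambda>k. 16 / a * r ^ k) sums (16 / a * (1 / (1 - r)))"
    using geometric_sums[of r] r by (intro sums_mult) auto
  have summ: "summable (\<lambda>k. prob (Bk k))"
    using Bk_prob by (intro summable_comparison_test'[OF sums_summable[OF r_sums]]) (auto simp: r_def)
  have "prob (\<Union>k. Bk k) \<le> (\<Sum>k. prob (Bk k))"
    using summ Bk by (intro finite_measure_subadditive_countably) auto
  also have "\<dots> \<le> (\<Sum>k. 16 / a * r ^ k)"
    using summ r_sums Bk_prob by (intro suminf_le) (auto simp: r_def sums_iff)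
  also have "\<dots> = 16 / (a * (1 - r))" using r_sums by (simp add: sums_iff)
  finally have prob: "prob (\<Union>k. Bk k) \<le> 16 / (a * (1 - 2 powr (-w)))" by (simp add: r_def)
  define q :: real where "q = (1/2) powr \<theta>"
  have q: "0 < q" "q < 1" using \<theta> powr_less_mono2[of \<theta> "1/2" 1] by (auto simp: q_def)
  have t_geo: "t (j + k) = t j * q ^ k" for j k
  proof -
    have "(x ^ k) powr \<theta> = (x powr \<theta>) ^ k" if "x \<ge> 0" for x :: real
      using that by (induction k) (simp_all add: powr_mult)
    from this[of "1/2"] have "((1/2) ^ k) powr \<theta> = q ^ k" by (simp add: q_def)
    moreover have "\<delta> (j + k) = \<delta> j * (1/2) ^ k" by (simp add: \<delta>_def power_add)
    ultimately have "\<delta> (j + k) powr \<theta> = \<delta> j powr \<theta> * q ^ k"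
      using \<delta>[of j] by (simp only: powr_mult)
    then show ?thesis by (simp add: t_def)
  qed
  have t_sums: "(\<lambda>k. t (j + k)) sums (t j * (1 / (1 - q)))" for j
    unfolding t_geo using geometric_sums[of q] q by (intro sums_mult) auto
  have main: "\<bar>e \<omega> \<bullet> x\<bar> \<le> 2 * B / (1 - q) * sqrt A * l2_norm x powr \<theta>"
    if \<omega>: "\<omega> \<in> space M - (\<Union>k. Bk k)" and x: "x \<in> S" for \<omega> x
  proof (cases "l2_norm x = 0")
    case True
    then have "x = 0\<^sub>v n" using l2_norm_eq_0_iff[of x n] x S by auto
    then show ?thesis using \<omega> by simp
  next
    case False
    then have pos: "l2_norm x > 0" using l2_norm_nonneg[of x] by simp
    have lim: "\<delta> \<longlonglongrightarrow> 0"
      unfolding \<delta>_def by (intro tendsto_mult_right_zero LIMSEQ_realpow_zero) auto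
    have ex: "\<exists>j. \<delta> (Suc j) < l2_norm x"
    proof -
      have "\<forall>\<^sub>F j in sequentially. \<delta> (Suc j) < l2_norm x"
        using order_tendstoD(2)[OF LIMSEQ_Suc[OF lim] pos] .
      then show ?thesis by (auto simp: eventually_sequentially)
    qed
    \<comment> \<open>The level matched to \<open>x\<close>: its norm is at most
      \<open>\<delta> j\<close>, by minimality or, for \<open>j = 0\<close>, by the choice of the
      radius, and \<open>\<delta> j\<close> is less than twice the norm. The second fact turns a
      bound in the scale into a bound in the norm of \<open>x\<close>.\<close>
    define j where "j = (LEAST j. \<delta> (Suc j) < l2_norm x)"
    have j1: "\<delta> (Suc j) < l2_norm x" unfolding j_def using ex by (rule LeastI_ex)
    have j2: "l2_norm x \<le> \<delta> j"
    proof (cases j)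
      case 0
      then show ?thesis using \<rho>(2)[OF x] by (simp add: \<delta>_def)
    next
      case (Suc i)
      then have "\<not> \<delta> (Suc i) < l2_norm x" unfolding j_def using not_less_Least by (metis lessI)
      then show ?thesis using Suc by simp
    qed
    have "\<bar>e \<omega> \<bullet> x\<bar> \<le> (\<Sum>k. t (j + k))"
    proof (rule chaining_bound[where n = n and C = C and \<delta> = \<delta>])
      show "e \<omega> \<in> carrier_vec n" "x \<in> carrier_vec n" using \<omega> x S by auto
      show "\<bar>e \<omega> \<bullet> (b - c)\<bar> \<le> t k" if "c \<in> C k" "b \<in> C (Suc k)" "l2_norm (b - c) \<le> 2 * \<delta> k" for k c b
      proof -
        have "(c, b) \<in> I k" using that by (simp add: I_def)
        then have "\<omega> \<notin> Ev (c, b) k" using \<omega> by (auto simp: Bk_def)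
        then show ?thesis using \<omega> by (auto simp: Ev_def)
      qed
      show "summable (\<lambda>k. t (j + k))" using t_sums by (rule sums_summable)
      show "\<delta> (Suc k) \<le> \<delta> k" for k using \<delta>[of k] by (simp add: \<delta>_Suc)
    qed (use C net x lim j2 less_imp_le[OF t_pos] in auto)
    also have "\<dots> = t j * (1 / (1 - q))" using t_sums by (simp add: sums_iff)
    finally have *: "\<bar>e \<omega> \<bullet> x\<bar> \<le> t j * (1 / (1 - q))" .
    have "t j \<le> B * sqrt A * 2 powr (w/2) * (2 * l2_norm x) powr \<theta>"
      unfolding t_def using j1 \<delta>[of j] \<theta> B A by (intro mult_left_mono powr_mono2) (auto simp: \<delta>_Suc)
    also have "\<dots> = 2 * B * sqrt A * l2_norm x powr \<theta>"
    proof -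
      have "(2::real) powr (w/2) * 2 powr \<theta> = 2" by (simp add: powr_add[symmetric] \<theta>_def)
      then have "B * sqrt A * (2 powr (w/2) * 2 powr \<theta>) * l2_norm x powr \<theta> = 2 * B * sqrt A * l2_norm x powr \<theta>"
        by simp
      then show ?thesis using pos by (simp add: powr_mult mult.assoc)
    qed
    finally have "t j * (1 / (1 - q)) \<le> 2 * B * sqrt A * l2_norm x powr \<theta> * (1 / (1 - q))"
      using q by (intro mult_right_mono) auto
    with * show ?thesis by (simp add: mult.commute mult.left_commute)
  qed
  show ?thesis
    using prob main Bk unfolding B_def q_def \<theta>_def by (intro bexI[of _ "\<Union>k. Bk k"]) auto
qed

subsection \<open>The generalized lasso\<close>

text \<open>A value \<open>m\<close> of the infimum lies below \<open>Suc m\<close>, so some cover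
  has at most \<open>m\<close> centres. Nonemptiness of \<open>S\<close> makes \<open>card C\<close>
  positive, which the comparison of logarithms requires.\<close>

lemma covering_number_cover:
  assumes h: "ln_enat (covering_number n \<delta> S) \<le> ereal h" and S: "S \<noteq> {}"
  shows "\<exists>C. finite C \<and> C \<subseteq> carrier_vec n \<and> S \<subseteq> (\<Union>c\<in>C. l2_ball n c \<delta>) \<and> real (card C) \<le> exp h"
proof -
  obtain m where m: "covering_number n \<delta> S = enat m"
    using h by (cases "covering_number n \<delta> S") (auto simp: ln_enat_def)
  then have "covering_number n \<delta> S < enat (Suc m)" by simp
  then obtain C where C: "finite C" "C \<subseteq> carrier_vec n" "S \<subseteq> (\<Union>c\<in>C. l2_ball n c \<delta>)" "card C < Suc m"
    unfolding covering_number_def INF_less_iff by auto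
  have "card C > 0" using C S by (auto simp: card_gt_0_iff)
  then have "ln (real (card C)) \<le> ln (real m)" using C(4) by simp
  also have "\<dots> \<le> h" using h m by (simp add: ln_enat_def)
  finally have "real (card C) \<le> exp h" using \<open>card C > 0\<close>
    by (metis exp_le_cancel_iff exp_ln of_nat_0_less_iff)
  then show ?thesis using C by blast
qed

section \<open>Scaling, symmetry and nontriviality of the set \<open>unit_row_set\<close>\<close>

lemma row_space_smult:
  assumes "D \<in> carrier_mat r n" "x \<in> vec_space.row_space n (D :: real mat)"
  shows "c \<cdot>\<^sub>v x \<in> vec_space.row_space n D"
proof -
  interpret vec_space "TYPE(real)" n .
  show ?thesis
    using assms rows_carrier[of D] smult_in_span[of "set (rows D)" x c] by (simp add: row_space_def)
qed

lemma row_space_carrier: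
  assumes "D \<in> carrier_mat r n" "x \<in> vec_space.row_space n (D :: real mat)"
  shows "x \<in> carrier_vec n"
proof -
  interpret vec_space "TYPE(real)" n .
  show ?thesis using assms row_space_eq[OF assms(1)] by auto
qed

lemma unit_row_set_smult:
  assumes D: "D \<in> carrier_mat r n" and x: "x \<in> vec_space.row_space n D"
    and c: "\<bar>c\<bar> * l1_norm (D *\<^sub>v x) \<le> 1"
  shows "c \<cdot>\<^sub>v x \<in> unit_row_set n D"
  using row_space_smult[OF D x] mult_mat_vec[OF D row_space_carrier[OF D x]] c
  by (simp add: unit_row_set_def l1_norm_smult)

lemma unit_row_set_carrier: "D \<in> carrier_mat r n \<Longrightarrow> unit_row_set n D \<subseteq> carrier_vec n"
  using row_space_carrier by (auto simp: unit_row_set_def)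

lemma unit_row_set_scale:
  assumes D: "D \<in> carrier_mat r n" and x: "x \<in> unit_row_set n D" and c: "\<bar>c\<bar> \<le> 1"
  shows "c \<cdot>\<^sub>v x \<in> unit_row_set n D"
proof (rule unit_row_set_smult[OF D])
  show "x \<in> vec_space.row_space n D" using x by (simp add: unit_row_set_def)
  have "l1_norm (D *\<^sub>v x) \<le> 1" using x by (simp add: unit_row_set_def)
  then show "\<bar>c\<bar> * l1_norm (D *\<^sub>v x) \<le> 1" using c by (intro mult_le_one l1_norm_nonneg) auto
qed

lemma unit_row_set_uminus:
  assumes D: "D \<in> carrier_mat r n" and x: "x \<in> unit_row_set n D"
  shows "- x \<in> unit_row_set n D"
proof -
  have "- x = (-1) \<cdot>\<^sub>v x" using x unit_row_set_carrier[OF D] by (intro eq_vecI) auto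
  then show ?thesis using unit_row_set_scale[OF D x, of "-1"] by simp
qed

text \<open>The row space part of \<open>b\<close> has the same image under \<open>D\<close> as
  \<open>b\<close>, hence is nonzero, and a small multiple of it lies in the set. This supplies the
  nontriviality that \<open>entropy_parameters_pos\<close> asks for.\<close>

lemma unit_row_set_nontrivial:
  assumes D: "D \<in> carrier_mat r n" and b: "b \<in> carrier_vec n" and nz: "D *\<^sub>v b \<noteq> 0\<^sub>v r"
  shows "\<not> unit_row_set n D \<subseteq> {0\<^sub>v n}"
proof -
  obtain U where U: "b - orth_proj n U b \<in> vec_space.row_space n D" "D *\<^sub>v orth_proj n U b = 0\<^sub>v r"
    using kernel_row_space_decomposition[OF D] b by metis
  define R where "R = b - orth_proj n U b"
  have R: "R \<in> vec_space.row_space n D" "R \<in> carrier_vec n" using U(1) b by (auto simp: R_def)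
  have DR: "D *\<^sub>v R = D *\<^sub>v b"
    using mult_minus_distrib_mat_vec[OF D b orth_proj_carrier, of U b] U(2) D b unfolding R_def by auto
  have "D *\<^sub>v 0\<^sub>v n = 0\<^sub>v r" using D by (intro eq_vecI) auto
  then have Rnz: "R \<noteq> 0\<^sub>v n" using DR nz by auto
  define c where "c = 1 / (1 + l1_norm (D *\<^sub>v R))"
  have c: "c > 0" using l1_norm_nonneg[of "D *\<^sub>v R"] by (simp add: c_def)
  have "\<bar>c\<bar> * l1_norm (D *\<^sub>v R) \<le> 1" using l1_norm_nonneg[of "D *\<^sub>v R"] by (simp add: c_def field_simps)
  then have "c \<cdot>\<^sub>v R \<in> unit_row_set n D" using unit_row_set_smult[OF D R(1)] by simp
  moreover have "c \<cdot>\<^sub>v R \<noteq> 0\<^sub>v n"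
  proof
    assume "c \<cdot>\<^sub>v R = 0\<^sub>v n"
    then have "\<bar>c\<bar> * l2_norm R = 0" by (metis l2_norm_smult l2_norm_zero)
    then show False using c Rnz l2_norm_eq_0_iff[OF R(2)] by simp
  qed
  ultimately show ?thesis by auto
qed

lemma zero_in_unit_row_set:
  assumes D: "D \<in> carrier_mat r n"
  shows "0\<^sub>v n \<in> unit_row_set n D"
proof -
  interpret vec_space "TYPE(real)" n .
  have "0\<^sub>v n \<in> row_space D" unfolding row_space_def using span_zero[of "set (rows D)"] by simp
  moreover have "D *\<^sub>v 0\<^sub>v n = 0\<^sub>v r" using D by (intro eq_vecI) auto
  then have "l1_norm (D *\<^sub>v 0\<^sub>v n) \<le> 1" by (simp add: l1_norm_def)
  ultimately show ?thesis by (simp add: unit_row_set_def)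
qed

text \<open>Rules out \<open>w \<le> 0\<close> for a nontrivial \<open>\<Delta>\<close>: covering numbers of a segment are unbounded.\<close>
lemma segment_card_cover:
  assumes x: "x \<in> carrier_vec n" "x \<noteq> 0\<^sub>v n" and m: "m > 0" and \<delta>: "2 * \<delta> < l2_norm x / real m"
    and C: "finite C" "C \<subseteq> carrier_vec n"
    and cov: "\<And>c. \<bar>c\<bar> \<le> 1 \<Longrightarrow> c \<cdot>\<^sub>v x \<in> (\<Union>c\<in>C. l2_ball n c \<delta>)"
  shows "m < card C"
proof -
  have "\<exists>c\<in>C. l2_norm ((real i / real m) \<cdot>\<^sub>v x - c) \<le> \<delta>" if "i \<le> m" for i
    using cov[of "real i / real m"] that m by (auto simp: l2_ball_def)
  then obtain f where f: "\<And>i. i \<le> m \<Longrightarrow> f i \<in> C"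
    "\<And>i. i \<le> m \<Longrightarrow> l2_norm ((real i / real m) \<cdot>\<^sub>v x - f i) \<le> \<delta>" by metis
  \<comment> \<open>The \<open>m + 1\<close> equally spaced points are pairwise at least
    \<open>l2_norm x / real m\<close> apart, more than the diameter \<open>2 * \<delta>\<close> of a
    ball, so no centre serves two of them.\<close>
  have "inj_on f {..m}"
  proof (rule inj_onI, rule ccontr)
    fix i j assume ij: "i \<in> {..m}" "j \<in> {..m}" "f i = f j" "i \<noteq> j"
    have fc: "f i \<in> carrier_vec n" using f ij C by auto
    have "1 \<le> \<bar>real i - real j\<bar>" using ij(4) by linarith
    then have "1 * (l2_norm x / real m) \<le> \<bar>real i - real j\<bar> * (l2_norm x / real m)"
      by (intro mult_right_mono) (auto simp: l2_norm_nonneg)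
    also have "\<dots> = l2_norm (((real i - real j) / real m) \<cdot>\<^sub>v x)"
      using m by (simp add: l2_norm_smult)
    also have "((real i - real j) / real m) \<cdot>\<^sub>v x = (real i / real m) \<cdot>\<^sub>v x - (real j / real m) \<cdot>\<^sub>v x"
      using x by (intro eq_vecI) (auto simp: diff_divide_distrib algebra_simps)
    also have "l2_norm \<dots> \<le> l2_norm ((real i / real m) \<cdot>\<^sub>v x - f i) + l2_norm (f i - (real j / real m) \<cdot>\<^sub>v x)"
      using x fc by (intro l2_norm_triangle_diff) auto
    also have "\<dots> \<le> 2 * \<delta>"
      using f(2)[of i] f(2)[of j] ij l2_norm_minus_commute[of "f i" n "(real j / real m) \<cdot>\<^sub>v x"] fc x by simp
    finally show False using \<delta> by simp
  qed
  then have "card {..m} \<le> card C" using f(1) C(1) by (intro card_inj_on_le[of f]) auto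
  then show ?thesis by simp
qed

section \<open>Consequences of the entropy hypothesis\<close>

lemma entropy_cover:
  assumes n: "n > 0"
    and ent: "\<forall>\<delta>>0. ln_enat (covering_number n \<delta> (unit_row_set n D)) \<le> ereal (E * (sqrt (real n) / \<delta>) powr w)"
    and S: "unit_row_set n D \<noteq> {}" and \<delta>: "\<delta> > 0"
  shows "\<exists>C. finite C \<and> C \<subseteq> carrier_vec n \<and> unit_row_set n D \<subseteq> (\<Union>c\<in>C. l2_ball n c \<delta>)
      \<and> real (card C) \<le> exp (E * real n powr (w/2) * \<delta> powr (-w))"
proof -
  \<comment> \<open>The hypothesis takes the form \<open>A * \<delta> powr (-w)\<close> with
    \<open>A = E * real n powr (w/2)\<close>, so that \<open>sqrt A\<close> becomes the constant
    \<open>sqrt E * real n powr (w/4)\<close> of the supremum bound.\<close>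
  have "sqrt (real n) powr w = real n powr (w/2)"
    by (simp add: powr_half_sqrt[symmetric] powr_powr)
  then have "E * (sqrt (real n) / \<delta>) powr w = E * real n powr (w/2) * \<delta> powr (-w)"
    using \<delta> by (simp add: powr_divide powr_minus field_simps)
  then show ?thesis using covering_number_cover[OF _ S] ent \<delta> by metis
qed

text \<open>A nonempty set takes at least one ball, so its entropy at scale 1 is nonnegative. This
  includes the trivial set, for which \<open>E = 0\<close> is possible.\<close>

lemma entropy_constant_nonneg:
  assumes D: "D \<in> carrier_mat r n" and n: "n > 0"
    and ent: "\<forall>\<delta>>0. ln_enat (covering_number n \<delta> (unit_row_set n D)) \<le> ereal (E * (sqrt (real n) / \<delta>) powr w)"
  shows "E \<ge> 0"
proof -
  have ne: "unit_row_set n D \<noteq> {}" using zero_in_unit_row_set[OF D] by auto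
  obtain C where C: "finite C" "unit_row_set n D \<subseteq> (\<Union>c\<in>C. l2_ball n c 1)"
    "real (card C) \<le> exp (E * real n powr (w/2))"
    using entropy_cover[OF n ent ne, of 1] by auto
  have "card C > 0" using C ne by (auto simp: card_gt_0_iff)
  then have "1 \<le> exp (E * real n powr (w/2))" using C(3) by linarith
  then show "E \<ge> 0" using n by (simp add: zero_le_mult_iff)
qed

text \<open>Positivity of \<open>E\<close> comes from the entropy at half the radius. If
  \<open>w \<le> 0\<close>, the hypothesis would allow covers with at most \<open>exp A\<close>
  centres at every scale below 1, contradicting the growth for a segment inside the set.\<close>

lemma entropy_parameters_pos:
  assumes D: "D \<in> carrier_mat r n" and n: "n > 0"
    and ent: "\<forall>\<delta>>0. ln_enat (covering_number n \<delta> (unit_row_set n D)) \<le> ereal (E * (sqrt (real n) / \<delta>) powr w)"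
    and S: "\<not> unit_row_set n D \<subseteq> {0\<^sub>v n}"
  shows "w > 0" "E > 0"
proof -
  obtain x where x: "x \<in> unit_row_set n D" "x \<noteq> 0\<^sub>v n" using S by auto
  have xc: "x \<in> carrier_vec n" using x unit_row_set_carrier[OF D] by auto
  define A where "A = E * real n powr (w/2)"
  have cover: "\<exists>C. finite C \<and> C \<subseteq> carrier_vec n \<and> unit_row_set n D \<subseteq> (\<Union>c\<in>C. l2_ball n c \<delta>)
      \<and> real (card C) \<le> exp (A * \<delta> powr (-w))" if "\<delta> > 0" for \<delta>
    unfolding A_def by (rule entropy_cover[OF n ent _ that]) (use x in auto)
  obtain \<rho> where \<rho>: "\<rho> > 0" "ln 2 \<le> A * (\<rho> / 2) powr (-w)"
    using entropy_radius[OF unit_row_set_carrier[OF D] unit_row_set_uminus[OF D] x, of "\<lambda>\<delta>. A * \<delta> powr (-w)"] cover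
    by metis
  have "0 < A * (\<rho> / 2) powr (-w)" using \<rho> ln_gt_zero[of 2] by linarith
  then have A: "A > 0" using \<rho> by (simp add: zero_less_mult_iff)
  then show "E > 0" using n by (simp add: A_def zero_less_mult_iff)
  show "w > 0"
  proof (rule ccontr)
    assume w: "\<not> w > 0"
    define m where "m = nat \<lceil>exp A\<rceil>"
    have m: "real m \<ge> exp A" unfolding m_def by linarith
    then have m0: "m > 0" using exp_gt_zero[of A] by (cases m) auto
    have px: "l2_norm x > 0" using l2_norm_eq_0_iff[OF xc] x l2_norm_nonneg[of x] by simp
    \<comment> \<open>The cap 1 gives \<open>\<delta> powr (-w) \<le> 1\<close>; the 4 in place of 2
      leaves room for the strict inequality \<open>\<delta>2\<close>.\<close>
    define \<delta> where "\<delta> = min 1 (l2_norm x / (4 * real m))"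
    have \<delta>: "0 < \<delta>" "\<delta> \<le> 1" using px m0 by (auto simp: \<delta>_def)
    have "4 * \<delta> \<le> l2_norm x / real m" by (simp add: \<delta>_def min_def field_simps)
    then have \<delta>2: "2 * \<delta> < l2_norm x / real m" using \<delta> by linarith
    obtain C where C: "finite C" "C \<subseteq> carrier_vec n" "unit_row_set n D \<subseteq> (\<Union>c\<in>C. l2_ball n c \<delta>)"
      "real (card C) \<le> exp (A * \<delta> powr (-w))" using cover[OF \<delta>(1)] by auto
    have "m < card C"
      using unit_row_set_scale[OF D x(1)] C(3)
      by (intro segment_card_cover[OF xc x(2) m0 \<delta>2 C(1,2)]) blast
    moreover have "\<delta> powr (-w) \<le> 1" using \<delta> w by (intro powr_le1) auto
    then have "A * \<delta> powr (-w) \<le> A" using A by simp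
    then have "exp (A * \<delta> powr (-w)) \<le> exp A" by simp
    ultimately show False using C(4) m by linarith
  qed
qed

text \<open>The constant is fixed before the probability space, the dimension, the operator and
  \<open>E\<close>, and depends on \<open>w\<close>, \<open>\<sigma>\<close> and
  \<open>\<eta>\<close> only. This is the uniformity that boundedness in probability
  demands.\<close>

lemma row_sup_bound:
  assumes w: "w < 2" and \<sigma>: "\<sigma> > 0" and \<eta>: "\<eta> > 0"
  obtains C where "C > 0"
    "\<And>(M :: 'a measure) n r D E e. prob_space M \<Longrightarrow> gaussian_noise M n \<sigma> e \<Longrightarrow> D \<in> carrier_mat r n \<Longrightarrow> n > 0 \<Longrightarrow>
      \<forall>\<delta>>0. ln_enat (covering_number n \<delta> (unit_row_set n D)) \<le> ereal (E * (sqrt (real n) / \<delta>) powr w) \<Longrightarrow>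
      \<exists>Bad\<in>sets M. emeasure M Bad \<le> ennreal \<eta> \<and> (\<forall>\<omega>\<in>space M - Bad. \<forall>x\<in>unit_row_set n D.
        \<bar>e \<omega> \<bullet> x\<bar> \<le> C * (sqrt E * real n powr (w/4)) * l2_norm x powr (1 - w/2))"
proof -
  \<comment> \<open>Solves \<open>16 / (a * (1 - 2 powr (-w))) = \<eta>\<close>, the failure
    probability in \<open>gaussian_sup_bound\<close>.\<close>
  define a where "a = 16 / (\<eta> * (1 - 2 powr (-w)))"
  \<comment> \<open>For \<open>w \<le> 0\<close> the set is trivial and both sides of the bound
    vanish, so the value 1 is arbitrary.\<close>
  define C where "C = (if w > 0 then 2 * sqrt (8 * \<sigma>\<^sup>2 * (a + 2)) / (1 - (1/2) powr (1 - w/2)) else 1)"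
  have r: "2 powr (-w) < 1" if "w > 0" using that powr_less_mono[of "-w" 0 2] by simp
  have a: "a > 0" if "w > 0" using r[OF that] \<eta> by (simp add: a_def)
  have "C > 0"
    using a \<sigma> w powr_less_mono2[of "1 - w/2" "1/2" 1] by (auto simp: C_def)
  moreover have "\<exists>Bad\<in>sets M. emeasure M Bad \<le> ennreal \<eta> \<and> (\<forall>\<omega>\<in>space M - Bad. \<forall>x\<in>unit_row_set n D.
        \<bar>e \<omega> \<bullet> x\<bar> \<le> C * (sqrt E * real n powr (w/4)) * l2_norm x powr (1 - w/2))"
    if M: "prob_space M" "gaussian_noise M n \<sigma> e" and D: "D \<in> carrier_mat r n" and n: "n > 0"
      and ent: "\<forall>\<delta>>0. ln_enat (covering_number n \<delta> (unit_row_set n D)) \<le> ereal (E * (sqrt (real n) / \<delta>) powr w)"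
    for M :: "'a measure" and n r D E e
  proof -
    interpret gaussian_vector M n \<sigma> e
      using M \<sigma> by (simp add: gaussian_vector_def gaussian_vector_axioms_def)
    show ?thesis
    proof (cases "unit_row_set n D \<subseteq> {0\<^sub>v n}")
      case True
      then have "\<bar>e \<omega> \<bullet> x\<bar> \<le> C * (sqrt E * real n powr (w/4)) * l2_norm x powr (1 - w/2)"
        if "\<omega> \<in> space M" "x \<in> unit_row_set n D" for \<omega> x
        using that subsetD[OF True that(2)] by auto
      then show ?thesis by (intro bexI[of _ "{}"]) auto
    next
      case False
      note pos = entropy_parameters_pos[OF D n ent False]
      obtain x where x: "x \<in> unit_row_set n D" "x \<noteq> 0\<^sub>v n" using False by auto
      have "sqrt (real n powr (w/2)) = real n powr (w/4)"
        by (simp add: powr_half_sqrt[symmetric] powr_powr)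
      then have sq: "sqrt (E * real n powr (w/2)) = sqrt E * real n powr (w/4)"
        by (simp add: real_sqrt_mult)
      have cov: "\<exists>C. finite C \<and> C \<subseteq> carrier_vec n \<and> unit_row_set n D \<subseteq> (\<Union>c\<in>C. l2_ball n c \<delta>)
          \<and> real (card C) \<le> exp (E * real n powr (w/2) * \<delta> powr (-w))" if "\<delta> > 0" for \<delta>
        by (rule entropy_cover[OF n ent _ that]) (use x in auto)
      have "16 / (16 / (\<eta> * c) * c) = \<eta>" if "c > 0" for c using that \<eta> by simp
      from this[of "1 - 2 powr (-w)"] have "16 / (a * (1 - 2 powr (-w))) = \<eta>"
        using r[OF pos(1)] by (simp add: a_def)
      then obtain Bad where Bad: "Bad \<in> events" "prob Bad \<le> \<eta>"
        "\<forall>\<omega>\<in>space M - Bad. \<forall>x\<in>unit_row_set n D. \<bar>e \<omega> \<bullet> x\<bar>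
          \<le> C * (sqrt E * real n powr (w/4)) * l2_norm x powr (1 - w/2)"
        using gaussian_sup_bound[OF unit_row_set_carrier[OF D] unit_row_set_uminus[OF D] x cov pos(1) w a[OF pos(1)]]
        unfolding sq C_def using pos(1) by (auto simp: mult.assoc)
      then show ?thesis by (intro bexI[of _ Bad]) (auto simp: emeasure_eq_measure intro: ennreal_leI)
    qed
  qed
  ultimately show thesis by (rule that)
qed

section \<open>Deterministic error analysis\<close>

lemma young_powr:
  fixes a x \<alpha> \<beta> :: real
  assumes "a \<ge> 0" "x \<ge> 0" "0 < \<alpha>" "\<alpha> < \<beta>"
  shows "a * x powr \<alpha> \<le> x powr \<beta> + a powr (\<beta> / (\<beta> - \<alpha>))"
\<comment> \<open>Young's inequality with unit weights: for small \<open>a\<close> the first term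
  alone dominates; for large \<open>a\<close>, \<open>x\<close> is bounded by a power of
  \<open>a\<close> and the second term dominates.\<close>
proof (cases "a \<le> x powr (\<beta> - \<alpha>)")
  case True
  then have "a * x powr \<alpha> \<le> x powr (\<beta> - \<alpha>) * x powr \<alpha>" by (intro mult_right_mono) auto
  also have "\<dots> = x powr \<beta>" by (simp add: powr_add[symmetric])
  finally show ?thesis by (simp add: add_increasing2)
next
  case False
  have a: "a > 0" using False assms powr_ge_zero[of x "\<beta> - \<alpha>"] by linarith
  have "x = (x powr (\<beta> - \<alpha>)) powr (1 / (\<beta> - \<alpha>))" using assms by (simp add: powr_powr)
  also have "\<dots> \<le> a powr (1 / (\<beta> - \<alpha>))" using False assms by (intro powr_mono2) auto
  finally have "x powr \<alpha> \<le> (a powr (1 / (\<beta> - \<alpha>))) powr \<alpha>" using assms by (intro powr_mono2) auto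
  then have "a * x powr \<alpha> \<le> a powr 1 * a powr (\<alpha> / (\<beta> - \<alpha>))" using a by (simp add: powr_powr)
  also have "\<dots> = a powr (\<beta> / (\<beta> - \<alpha>))"
    using assms by (simp only: powr_add[symmetric]) (simp add: field_simps)
  finally show ?thesis by (simp add: add_increasing)
qed

text \<open>Minimality is tested against \<open>\<beta>\<close> itself; after expanding the square,
  the squared norm of the noise cancels.\<close>

lemma gen_lasso_basic_inequality:
  assumes D: "D \<in> carrier_mat r n" and \<beta>: "\<beta> \<in> carrier_vec n" and e: "e \<in> carrier_vec n"
    and b: "is_gen_lasso n D l (\<beta> + e) b"
  shows "1/2 * (l2_norm (b - \<beta>))\<^sup>2 \<le> e \<bullet> (b - \<beta>) + l * (l1_norm (D *\<^sub>v \<beta>) - l1_norm (D *\<^sub>v b))"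
proof -
  have bc: "b \<in> carrier_vec n" and le: "lasso_objective D l (\<beta> + e) b \<le> lasso_objective D l (\<beta> + e) \<beta>"
    using b \<beta> by (auto simp: is_gen_lasso_def is_arg_min_def not_less)
  define d where "d = b - \<beta>"
  have d: "d \<in> carrier_vec n" using bc \<beta> by (simp add: d_def)
  have 1: "\<beta> + e - b = e - d" using bc \<beta> e by (intro eq_vecI) (auto simp: d_def)
  have 2: "\<beta> + e - \<beta> = e" using \<beta> e by (intro eq_vecI) auto
  have "(l2_norm (e - d))\<^sup>2 = e \<bullet> (e - d) - d \<bullet> (e - d)"
    unfolding l2_norm_sq using e d by (intro minus_scalar_prod_distrib) auto
  also have "\<dots> = (l2_norm e)\<^sup>2 - 2 * (e \<bullet> d) + (l2_norm d)\<^sup>2"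
    unfolding l2_norm_sq
    using scalar_prod_minus_distrib[OF e e d] scalar_prod_minus_distrib[OF d e d] comm_scalar_prod[OF e d] by simp
  finally show ?thesis using le unfolding lasso_objective_def 1 2 d_def[symmetric] by (simp add: algebra_simps)
qed

text \<open>The error is split into its kernel part \<open>P\<close> and its row space part
  \<open>R\<close>. Since \<open>D\<close> annihilates \<open>P\<close>, the vector \<open>R\<close>
  divided by \<open>G = T + L\<close> lies in \<open>unit_row_set\<close>. The supremum bound is
  homogeneous of degree \<open>1 - w/2\<close>, so rescaling leaves the factor
  \<open>G powr (w/2)\<close>.\<close>

lemma gen_lasso_error_bound:
  fixes w \<kappa> l N :: real
  assumes D: "D \<in> carrier_mat r n" and \<beta>: "\<beta> \<in> carrier_vec n" and e: "e \<in> carrier_vec n"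
    and b: "is_gen_lasso n D l (\<beta> + e) b"
    and U: "orthonormal_set n U" "\<And>d. d \<in> carrier_vec n \<Longrightarrow> d - orth_proj n U d \<in> vec_space.row_space n D"
      "\<And>d. d \<in> carrier_vec n \<Longrightarrow> D *\<^sub>v orth_proj n U d = 0\<^sub>v r"
    and N: "(\<Sum>u\<in>U. (e \<bullet> u)\<^sup>2) \<le> N"
    and sup: "\<And>x. x \<in> unit_row_set n D \<Longrightarrow> \<bar>e \<bullet> x\<bar> \<le> \<kappa> * l2_norm x powr (1 - w/2)"
    and \<kappa>: "\<kappa> \<ge> 0" and w: "0 < w" "w < 2" and nz: "D *\<^sub>v \<beta> \<noteq> 0\<^sub>v r"
  defines "L \<equiv> l1_norm (D *\<^sub>v \<beta>)" and "T \<equiv> l1_norm (D *\<^sub>v b)" and "d \<equiv> l2_norm (b - \<beta>)"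
  shows "1/2 * d\<^sup>2 \<le> sqrt N * d + \<kappa> * (T + L) powr (w/2) * d powr (1 - w/2) + l * (L - T)"
proof -
  have bc: "b \<in> carrier_vec n" using b by (auto simp: is_gen_lasso_def is_arg_min_def)
  define v where "v = b - \<beta>"
  have v: "v \<in> carrier_vec n" using bc \<beta> by (simp add: v_def)
  define P where "P = orth_proj n U v"
  define R where "R = v - P"
  have P: "P \<in> carrier_vec n" by (simp add: P_def)
  have R: "R \<in> carrier_vec n" using v P by (simp add: R_def)
  have L: "L > 0"
    using l1_norm_eq_0_iff[OF mult_mat_vec_carrier[OF D \<beta>]] nz l1_norm_nonneg[of "D *\<^sub>v \<beta>"] by (simp add: L_def less_le)
  define G where "G = T + L"
  have G: "G > 0" using L l1_norm_nonneg[of "D *\<^sub>v b"] by (simp add: G_def T_def)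
  have eP: "e \<bullet> P \<le> sqrt N * d"
  proof -
    have "e \<bullet> P \<le> sqrt (\<Sum>u\<in>U. (e \<bullet> u)\<^sup>2) * d"
      using scalar_prod_orth_proj_le(1)[OF U(1) e v] by (simp add: P_def v_def d_def)
    also have "\<dots> \<le> sqrt N * d" using N by (intro mult_right_mono) (auto simp: d_def l2_norm_nonneg)
    finally show ?thesis .
  qed
  have DR: "D *\<^sub>v R = D *\<^sub>v b - D *\<^sub>v \<beta>"
  proof -
    have "D *\<^sub>v R = D *\<^sub>v v - D *\<^sub>v P" unfolding R_def by (rule mult_minus_distrib_mat_vec[OF D v P])
    also have "D *\<^sub>v v = D *\<^sub>v b - D *\<^sub>v \<beta>" unfolding v_def by (rule mult_minus_distrib_mat_vec[OF D bc \<beta>])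
    finally show ?thesis using U(3)[OF v] D by (intro eq_vecI) (auto simp: P_def)
  qed
  have "l1_norm (D *\<^sub>v R) \<le> G"
    unfolding DR G_def T_def L_def 
    by (rule l1_norm_diff_le[OF mult_mat_vec_carrier[OF D bc] mult_mat_vec_carrier[OF D \<beta>]])
  then have x: "(1 / G) \<cdot>\<^sub>v R \<in> unit_row_set n D"
    using U(2)[OF v] G by (intro unit_row_set_smult[OF D]) (auto simp: R_def P_def)
  have "\<bar>e \<bullet> R\<bar> = G * \<bar>e \<bullet> ((1 / G) \<cdot>\<^sub>v R)\<bar>" using e R G by (simp add: abs_mult)
  also have "\<dots> \<le> G * (\<kappa> * (l2_norm R / G) powr (1 - w/2))"
    using sup[OF x] G by (intro mult_left_mono) (auto simp: l2_norm_smult)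
  also have "\<dots> \<le> G * (\<kappa> * (d / G) powr (1 - w/2))"
    using scalar_prod_orth_proj_le(2)[OF U(1) e v] G \<kappa> w l2_norm_nonneg[of R]
    by (intro mult_left_mono powr_mono2 divide_right_mono) (auto simp: R_def P_def d_def v_def)
  also have "\<dots> = \<kappa> * G powr (w/2) * d powr (1 - w/2)"
  proof -
    have "G = G powr (w/2) * G powr (1 - w/2)" using G by (simp add: powr_add[symmetric])
    then have GG: "G / G powr (1 - w/2) = G powr (w/2)" using G by (simp add: field_simps)
    have "G * (\<kappa> * (d / G) powr (1 - w/2)) = \<kappa> * (G / G powr (1 - w/2)) * d powr (1 - w/2)"
      using G l2_norm_nonneg[of "b - \<beta>"] by (simp add: powr_divide d_def)
    then show ?thesis unfolding GG .
  qed
  finally have eR: "\<bar>e \<bullet> R\<bar> \<le> \<kappa> * G powr (w/2) * d powr (1 - w/2)" .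
  have "e \<bullet> v = e \<bullet> P + e \<bullet> R"
    using scalar_prod_minus_distrib[OF e v P] by (simp add: R_def)
  then show ?thesis
    using gen_lasso_basic_inequality[OF D \<beta> e b] eP eR unfolding G_def L_def T_def d_def v_def by linarith
qed

text \<open>Young's inequality with exponents \<open>1 - w/2\<close> and 2 removes \<open>d\<close>
  from the mixed term and leaves \<open>(T + L) powr s\<close>. A second use, with exponents
  \<open>s\<close> and 1, makes this linear in \<open>T\<close>, so that the penalty can cancel
  it.\<close>

lemma error_rate_algebra:
  fixes w C K L T d N :: real
  assumes w: "0 < w" "w < 2" and C: "C > 0" and K: "K > 0" and L: "L > 0" and T: "T \<ge> 0" and d: "d \<ge> 0" and N: "N \<ge> 0"
    and le: "1/2 * d\<^sup>2 \<le> sqrt N * d + C * K * (T + L) powr (w/2) * d powr (1 - w/2)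
        + K powr (2 / (1 + w/2)) * L powr (- ((1 - w/2) / (1 + w/2))) * (L - T)"
  shows "d\<^sup>2 \<le> 8 * N + 4 * (2 + ((8 * C) powr (2 / (1 + w/2))) powr ((1 + w/2) / (1 - w/2)))
      * (K powr (2 / (1 + w/2)) * L powr (w / (1 + w/2)))"
proof -
  \<comment> \<open>In these terms the tuning parameter is \<open>K powr q * L powr (s - 1)\<close>
    and the target rate is \<open>K powr q * L powr s\<close>.\<close>
  define q where "q = 2 / (1 + w/2)"
  define s where "s = w / (1 + w/2)"
  have w1: "1 + w/2 > 0" using w by simp
  have s: "0 < s" "s < 1" using w by (auto simp: s_def field_simps)
  have s1: "- ((1 - w/2) / (1 + w/2)) = s - 1" using w1 by (simp add: s_def field_simps)
  have s2: "1 / (1 - s) = (1 + w/2) / (1 - w/2)" using w w1 by (simp add: s_def field_simps)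
  define P where "P = (8 * C) powr q"
  have P: "P > 0" using C by (simp add: P_def)
  define V where "V = T + L"
  have V: "V > 0" using T L by (simp add: V_def)
  define Q where "Q = K powr q"
  have Q: "Q > 0" using K by (simp add: Q_def)
  have "8 * C * K * V powr (w/2) * d powr (1 - w/2)
      \<le> d powr 2 + (8 * C * K * V powr (w/2)) powr (2 / (2 - (1 - w/2)))"
    using C K w d by (intro young_powr) auto
  also have "(8 * C * K * V powr (w/2)) powr (2 / (2 - (1 - w/2))) = P * Q * V powr s"
  proof -
    have q: "2 / (2 - (1 - w/2)) = q" by (simp add: q_def)
    have "w/2 * q = s" by (simp add: q_def s_def)
    then show ?thesis
      unfolding q using C K by (simp add: powr_mult powr_powr P_def Q_def)
  qed
  finally have A: "8 * (C * K * V powr (w/2) * d powr (1 - w/2)) \<le> d\<^sup>2 + P * Q * V powr s"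
    using d by (simp add: mult.assoc)
  \<comment> \<open>Young's inequality for the coefficient \<open>P * L powr (1 - s)\<close>, scaled
    back by \<open>L powr (s - 1)\<close>, gives \<open>V\<close> exactly the weight that the
    penalty has.\<close>
  have B: "P * V powr s \<le> V * L powr (s - 1) + P powr (1 / (1 - s)) * L powr s"
  proof -
    have "(P * L powr (1 - s)) * V powr s \<le> V powr 1 + (P * L powr (1 - s)) powr (1 / (1 - s))"
      using P V s by (intro young_powr) auto
    also have "(P * L powr (1 - s)) powr (1 / (1 - s)) = P powr (1 / (1 - s)) * L"
      using P L s by (simp add: powr_mult powr_powr)
    finally have "L powr (s - 1) * ((P * L powr (1 - s)) * V powr s) \<le> L powr (s - 1) * (V + P powr (1 / (1 - s)) * L)"
      using V by (intro mult_left_mono) auto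
    moreover have "L powr (s - 1) * ((P * L powr (1 - s)) * V powr s) = P * V powr s"
    proof -
      have "L powr (s - 1) * L powr (1 - s) = 1" using L by (simp add: powr_add[symmetric])
      then have "(L powr (s - 1) * L powr (1 - s)) * (P * V powr s) = P * V powr s" by simp
      then show ?thesis by (simp only: mult.assoc mult.commute mult.left_commute)
    qed
    moreover have "L powr (s - 1) * (V + P powr (1 / (1 - s)) * L)
        = V * L powr (s - 1) + P powr (1 / (1 - s)) * (L powr (s - 1) * L)"
      by (simp add: algebra_simps)
    moreover have "L powr (s - 1) * L = L powr s"
      using L by (simp add: powr_mult_base mult.commute)
    ultimately show ?thesis by simp
  qed
  have "sqrt N * d \<le> d\<^sup>2 / 8 + 2 * N"
  proof -
    have "0 \<le> (d - 4 * sqrt N)\<^sup>2" by simp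
    then have "8 * (sqrt N * d) \<le> d\<^sup>2 + 16 * N"
      using N by (simp add: power2_diff power_mult_distrib mult.commute)
    then show ?thesis by linarith
  qed
  \<comment> \<open>Of the half of \<open>d\<^sup>2\<close> on the left, one eighth pays for the
    kernel term and one eighth for the mixed term.\<close>
  moreover have "1/4 * x \<le> 2 * N + p / 8 + z"
    if "a \<le> x / 8 + 2 * N" "1/2 * x \<le> a + b + z" "8 * b \<le> x + p" for x a b z p :: real
    using that by (simp add: field_simps)
  ultimately have "1/4 * d\<^sup>2 \<le> 2 * N + P * Q * V powr s / 8 + Q * L powr (s - 1) * (L - T)"
    using le A unfolding s1 V_def[symmetric] q_def[symmetric] Q_def[symmetric] by blast
  also have "\<dots> \<le> 2 * N + Q * (P * V powr s) + Q * L powr (s - 1) * (L - T)"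
    using P Q by simp
  also have "\<dots> \<le> 2 * N + Q * (V * L powr (s - 1) + P powr (1 / (1 - s)) * L powr s) + Q * L powr (s - 1) * (L - T)"
    using B Q by simp
  \<comment> \<open>As \<open>V = T + L\<close>, the terms \<open>V * L powr (s - 1)\<close> and
    \<open>L powr (s - 1) * (L - T)\<close> add up to \<open>2 * L powr s\<close>, and
    \<open>T\<close> is gone.\<close>
  also have "\<dots> = 2 * N + (2 + P powr (1 / (1 - s))) * (Q * L powr s)"
  proof -
    have "L powr s = L powr (s - 1) * L" using L by (simp add: powr_mult_base mult.commute)
    then show ?thesis by (simp add: V_def algebra_simps)
  qed
  finally show ?thesis unfolding s2 P_def Q_def q_def[symmetric] s_def[symmetric]
    by (simp add: algebra_simps)
qed

section \<open>From deterministic bounds to boundedness in probability\<close>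

lemma max_ratio_abs_le:
  assumes S: "S \<subseteq> carrier_vec n" and c: "c \<ge> 0"
    and le: "\<And>x. x \<in> S \<Longrightarrow> \<bar>e \<bullet> x\<bar> \<le> c * l2_norm x powr p"
  shows "\<bar>max_ratio e p n S\<bar> \<le> ereal c"
proof (cases "S \<subseteq> {0\<^sub>v n}")
  case True
  then show ?thesis using c by (simp add: max_ratio_def)
next
  case False
  then obtain x\<^sub>0 where x\<^sub>0: "x\<^sub>0 \<in> S - {0\<^sub>v n}" by auto
  have *: "\<bar>e \<bullet> x / l2_norm x powr p\<bar> \<le> c" if "x \<in> S - {0\<^sub>v n}" for x
  proof -
    have "l2_norm x \<noteq> 0" using that S l2_norm_eq_0_iff[of x n] by auto
    then have "l2_norm x powr p > 0" by simp
    then show ?thesis using le[of x] that by (simp add: abs_divide pos_divide_le_eq)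
  qed
  have "(SUP x\<in>S - {0\<^sub>v n}. ereal (e \<bullet> x / l2_norm x powr p)) \<le> ereal c"
  proof (rule SUP_least)
    fix x assume "x \<in> S - {0\<^sub>v n}"
    from abs_le_D1[OF *[OF this]] show "ereal (e \<bullet> x / l2_norm x powr p) \<le> ereal c" by simp
  qed
  \<comment> \<open>Boundedness in probability concerns the absolute value, so the supremum is also
    bounded from below, by its value at one nonzero point.\<close>
  moreover have "ereal (- c) \<le> (SUP x\<in>S - {0\<^sub>v n}. ereal (e \<bullet> x / l2_norm x powr p))"
    using abs_le_D2[OF *[OF x\<^sub>0]] by (intro SUP_upper2[OF x\<^sub>0]) simp
  moreover have "\<bar>s\<bar> \<le> ereal c" if "s \<le> ereal c" "ereal (- c) \<le> s" for s
    using that by (cases s) auto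
  ultimately show ?thesis using False by (simp add: max_ratio_def)
qed

lemma outer_measure_of_le:
  assumes "B \<in> sets M" "A \<subseteq> B" "emeasure M B \<le> c"
  shows "outer_measure_of M A \<le> c"
  unfolding outer_measure_of_def by (rule INF_lower2[of B]) (use assms in auto)

text \<open>The rate is stated for \<open>\<Delta> n *\<^sub>v \<beta>\<^sub>0 n\<close> nonzero
  because the tuning parameter contains a power of its norm, negative for \<open>0 < w\<close>. By
  the convention \<open>0 powr a = 0\<close> a zero norm would give a zero parameter, and the
  estimate would be the data itself.\<close>

theorem theorem10:
  fixes M :: "nat \<Rightarrow> 'a measure"
    and \<sigma> w :: real
    and r :: "nat \<Rightarrow> nat"
    and \<Delta> :: "nat \<Rightarrow> real mat"
    and \<beta>\<^sub>0 :: "nat \<Rightarrow> real vec"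
    and \<epsilon> y :: "nat \<Rightarrow> 'a \<Rightarrow> real vec"
    and E :: "nat \<Rightarrow> real"
  assumes prob: "\<And>n. prob_space (M n)"
    and sigma: "\<sigma> > 0"
    and Delta: "\<And>n. \<Delta> n \<in> carrier_mat (r n) n"
    and beta0: "\<And>n. \<beta>\<^sub>0 n \<in> carrier_vec n"
    and noise: "\<And>n. gaussian_noise (M n) n \<sigma> (\<epsilon> n)"
    and data: "\<And>n \<omega>. \<omega> \<in> space (M n) \<Longrightarrow> y n \<omega> = \<beta>\<^sub>0 n + \<epsilon> n \<omega>"
    and w: "w < 2"
    and entropy: "\<forall>\<^sub>F n in sequentially. \<forall>\<delta>>0.
      ln_enat (covering_number n \<delta> (unit_row_set n (\<Delta> n)))
        \<le> ereal (E n * (sqrt (real n) / \<delta>) powr w)"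
  shows
    "bounded_in_prob M
       (\<lambda>n \<omega>. max_ratio (\<epsilon> n \<omega>) (1 - w/2) n (unit_row_set n (\<Delta> n)))
       (\<lambda>n. sqrt (E n) * real n powr (w/4))
     \<and>
     ((\<forall>\<^sub>F n in sequentially. \<Delta> n *\<^sub>v \<beta>\<^sub>0 n \<noteq> 0\<^sub>v (r n)) \<longrightarrow>
      (\<exists>c>0. \<forall>lam betahat.
         (\<forall>n. lam n = c * (E n powr (1 / (1 + w/2)) * real n powr ((w/2) / (1 + w/2))
                         * l1_norm (\<Delta> n *\<^sub>v \<beta>\<^sub>0 n) powr (- ((1 - w/2) / (1 + w/2))))) \<longrightarrow>
         (\<forall>n. \<forall>\<omega>\<in>space (M n). is_gen_lasso n (\<Delta> n) (lam n) (y n \<omega>) (betahat n \<omega>)) \<longrightarrow>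
         bounded_in_prob M
           (\<lambda>n \<omega>. ereal ((l2_norm (betahat n \<omega> - \<beta>\<^sub>0 n))\<^sup>2 / real n))
           (\<lambda>n. real (kernel_dim (\<Delta> n)) / real n
              + E n powr (1 / (1 + w/2)) * real n powr (- (1 / (1 + w/2)))
                * l1_norm (\<Delta> n *\<^sub>v \<beta>\<^sub>0 n) powr (w / (1 + w/2)))))"
    (is "?ratio \<and> (?nz \<longrightarrow> ?rate)")
proof
  have ev: "\<forall>\<^sub>F n in sequentially. n > 0 \<and> (\<forall>\<delta>>0. ln_enat (covering_number n \<delta> (unit_row_set n (\<Delta> n)))
        \<le> ereal (E n * (sqrt (real n) / \<delta>) powr w))"
    using entropy eventually_gt_at_top[of 0] by eventually_elim simp
  show ?ratio
    unfolding bounded_in_prob_def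
  proof (intro allI impI)
    fix \<eta> :: real assume "\<eta> > 0"
    obtain C where C: "C > 0"
      "\<And>(M :: 'a measure) n r D E e. prob_space M \<Longrightarrow> gaussian_noise M n \<sigma> e \<Longrightarrow> D \<in> carrier_mat r n \<Longrightarrow> n > 0 \<Longrightarrow>
        \<forall>\<delta>>0. ln_enat (covering_number n \<delta> (unit_row_set n D)) \<le> ereal (E * (sqrt (real n) / \<delta>) powr w) \<Longrightarrow>
        \<exists>Bad\<in>sets M. emeasure M Bad \<le> ennreal \<eta> \<and> (\<forall>\<omega>\<in>space M - Bad. \<forall>x\<in>unit_row_set n D.
          \<bar>e \<omega> \<bullet> x\<bar> \<le> C * (sqrt E * real n powr (w/4)) * l2_norm x powr (1 - w/2))"
      using row_sup_bound[OF w sigma \<open>\<eta> > 0\<close>] by blast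
    show "\<exists>C>0. \<forall>\<^sub>F n in sequentially. outer_measure_of (M n)
        {\<omega> \<in> space (M n). \<bar>max_ratio (\<epsilon> n \<omega>) (1 - w/2) n (unit_row_set n (\<Delta> n))\<bar>
          > ereal (C * (sqrt (E n) * real n powr (w/4)))} \<le> ennreal \<eta>"
    proof (intro exI[of _ C] conjI C(1) eventually_mono[OF ev])
      fix n assume n: "n > 0 \<and> (\<forall>\<delta>>0. ln_enat (covering_number n \<delta> (unit_row_set n (\<Delta> n)))
        \<le> ereal (E n * (sqrt (real n) / \<delta>) powr w))"
      obtain Bad where Bad: "Bad \<in> sets (M n)" "emeasure (M n) Bad \<le> ennreal \<eta>"
        "\<And>\<omega> x. \<omega> \<in> space (M n) - Bad \<Longrightarrow> x \<in> unit_row_set n (\<Delta> n) \<Longrightarrow>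
          \<bar>\<epsilon> n \<omega> \<bullet> x\<bar> \<le> C * (sqrt (E n) * real n powr (w/4)) * l2_norm x powr (1 - w/2)"
        using C(2)[OF prob noise Delta, of n "E n"] n by auto
      have K: "0 \<le> C * (sqrt (E n) * real n powr (w/4))"
        using entropy_constant_nonneg[OF Delta conjunct1[OF n] conjunct2[OF n]] C(1) by simp
      have "\<bar>max_ratio (\<epsilon> n \<omega>) (1 - w/2) n (unit_row_set n (\<Delta> n))\<bar> \<le> ereal (C * (sqrt (E n) * real n powr (w/4)))"
        if "\<omega> \<in> space (M n) - Bad" for \<omega>
        by (rule max_ratio_abs_le[OF unit_row_set_carrier[OF Delta] K Bad(3)[OF that]])
      then show "outer_measure_of (M n)
        {\<omega> \<in> space (M n). \<bar>max_ratio (\<epsilon> n \<omega>) (1 - w/2) n (unit_row_set n (\<Delta> n))\<bar>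
          > ereal (C * (sqrt (E n) * real n powr (w/4)))} \<le> ennreal \<eta>"
        by (intro outer_measure_of_le[OF Bad(1) _ Bad(2)]) (auto simp: not_less[symmetric])
    qed
  qed
  show "?nz \<longrightarrow> ?rate"
  \<comment> \<open>With the tuning constant 1, \<open>lam n\<close> is exactly the coefficient of
    the penalty in \<open>error_rate_algebra\<close>.\<close>
  proof (intro impI exI[of _ "1::real"] conjI allI)
    fix lam betahat
    assume nz: ?nz
      and lam: "\<forall>n. lam n = 1 * (E n powr (1 / (1 + w/2)) * real n powr ((w/2) / (1 + w/2))
                         * l1_norm (\<Delta> n *\<^sub>v \<beta>\<^sub>0 n) powr (- ((1 - w/2) / (1 + w/2))))"
      and lasso: "\<forall>n. \<forall>\<omega>\<in>space (M n). is_gen_lasso n (\<Delta> n) (lam n) (y n \<omega>) (betahat n \<omega>)"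
    define rate where "rate n = real (kernel_dim (\<Delta> n)) / real n
              + E n powr (1 / (1 + w/2)) * real n powr (- (1 / (1 + w/2)))
                * l1_norm (\<Delta> n *\<^sub>v \<beta>\<^sub>0 n) powr (w / (1 + w/2))" for n
    have "bounded_in_prob M (\<lambda>n \<omega>. ereal ((l2_norm (betahat n \<omega> - \<beta>\<^sub>0 n))\<^sup>2 / real n)) rate"
      unfolding bounded_in_prob_def
    proof (intro allI impI)
      fix \<eta> :: real assume \<eta>: "\<eta> > 0"
      then have "\<eta> / 2 > 0" by simp
      then obtain C where C: "C > 0"
        "\<And>(M :: 'a measure) n r D E e. prob_space M \<Longrightarrow> gaussian_noise M n \<sigma> e \<Longrightarrow> D \<in> carrier_mat r n \<Longrightarrow> n > 0 \<Longrightarrow>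
          \<forall>\<delta>>0. ln_enat (covering_number n \<delta> (unit_row_set n D)) \<le> ereal (E * (sqrt (real n) / \<delta>) powr w) \<Longrightarrow>
          \<exists>Bad\<in>sets M. emeasure M Bad \<le> ennreal (\<eta> / 2) \<and> (\<forall>\<omega>\<in>space M - Bad. \<forall>x\<in>unit_row_set n D.
            \<bar>e \<omega> \<bullet> x\<bar> \<le> C * (sqrt E * real n powr (w/4)) * l2_norm x powr (1 - w/2))"
        using row_sup_bound[OF w sigma] by blast
      \<comment> \<open>Lets the kernel part fail with probability at most
        \<open>\<eta> / 2\<close>; the supremum bound takes the other half.\<close>
      define C2 where "C2 = 8 * exp (\<sigma>\<^sup>2 / 2) / \<eta>"
      have C2: "C2 > 0" "4 * exp (\<sigma>\<^sup>2 / 2) / C2 = \<eta> / 2" using \<eta> by (auto simp: C2_def)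
      define C3 where "C3 = 4 * (2 + ((8 * C) powr (2 / (1 + w/2))) powr ((1 + w/2) / (1 - w/2)))"
      have C3: "C3 > 0" unfolding C3_def by (intro mult_pos_pos add_pos_nonneg) auto
      have ev2: "\<forall>\<^sub>F n in sequentially. (n > 0 \<and> (\<forall>\<delta>>0. ln_enat (covering_number n \<delta> (unit_row_set n (\<Delta> n)))
        \<le> ereal (E n * (sqrt (real n) / \<delta>) powr w))) \<and> \<Delta> n *\<^sub>v \<beta>\<^sub>0 n \<noteq> 0\<^sub>v (r n)"
        using ev nz by eventually_elim simp
      show "\<exists>C>0. \<forall>\<^sub>F n in sequentially. outer_measure_of (M n)
          {\<omega> \<in> space (M n). \<bar>ereal ((l2_norm (betahat n \<omega> - \<beta>\<^sub>0 n))\<^sup>2 / real n)\<bar> > ereal (C * rate n)} \<le> ennreal \<eta>"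
      \<comment> \<open>Here \<open>8 * C2\<close> multiplies the nullity and \<open>C3\<close> the
        entropy term; their sum dominates both.\<close>
      proof (intro exI[of _ "8 * C2 + C3"] conjI eventually_mono[OF ev2])
        show "8 * C2 + C3 > 0" using C2 C3 by simp
        fix n assume "(n > 0 \<and> (\<forall>\<delta>>0. ln_enat (covering_number n \<delta> (unit_row_set n (\<Delta> n)))
          \<le> ereal (E n * (sqrt (real n) / \<delta>) powr w))) \<and> \<Delta> n *\<^sub>v \<beta>\<^sub>0 n \<noteq> 0\<^sub>v (r n)"
        then have n: "n > 0" and ent: "\<forall>\<delta>>0. ln_enat (covering_number n \<delta> (unit_row_set n (\<Delta> n)))
            \<le> ereal (E n * (sqrt (real n) / \<delta>) powr w)" and nzn: "\<Delta> n *\<^sub>v \<beta>\<^sub>0 n \<noteq> 0\<^sub>v (r n)"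
          by auto
        interpret gaussian_vector "M n" n \<sigma> "\<epsilon> n"
          using prob noise sigma by (simp add: gaussian_vector_def gaussian_vector_axioms_def)
        note pos = entropy_parameters_pos[OF Delta n ent unit_row_set_nontrivial[OF Delta beta0 nzn]]
        obtain U where U: "orthonormal_set n U" "card U \<le> kernel_dim (\<Delta> n)"
          "\<And>d. d \<in> carrier_vec n \<Longrightarrow> d - orth_proj n U d \<in> vec_space.row_space n (\<Delta> n)"
          "\<And>d. d \<in> carrier_vec n \<Longrightarrow> \<Delta> n *\<^sub>v orth_proj n U d = 0\<^sub>v (r n)"
          using kernel_row_space_decomposition[OF Delta[of n]] by metis
        define Bad2 where "Bad2 = {\<omega> \<in> space (M n). (\<Sum>u\<in>U. (\<epsilon> n \<omega> \<bullet> u)\<^sup>2) > C2 * real (kernel_dim (\<Delta> n))}"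
        have Bad2: "Bad2 \<in> sets (M n)" "emeasure (M n) Bad2 \<le> ennreal (\<eta> / 2)"
          using sum_square_tail[OF U(1,2) C2(1)] unfolding C2(2) Bad2_def[symmetric]
          by (auto simp: emeasure_eq_measure intro: ennreal_leI)
        obtain Bad1 where Bad1: "Bad1 \<in> sets (M n)" "emeasure (M n) Bad1 \<le> ennreal (\<eta> / 2)"
          "\<And>\<omega> x. \<omega> \<in> space (M n) - Bad1 \<Longrightarrow> x \<in> unit_row_set n (\<Delta> n) \<Longrightarrow>
            \<bar>\<epsilon> n \<omega> \<bullet> x\<bar> \<le> C * (sqrt (E n) * real n powr (w/4)) * l2_norm x powr (1 - w/2)"
          using C(2)[OF prob noise Delta n ent] by auto
        have "emeasure (M n) (Bad1 \<union> Bad2) \<le> emeasure (M n) Bad1 + emeasure (M n) Bad2"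
          by (rule emeasure_subadditive[OF Bad1(1) Bad2(1)])
        also have "\<dots> \<le> ennreal (\<eta> / 2) + ennreal (\<eta> / 2)" by (rule add_mono[OF Bad1(2) Bad2(2)])
        also have "\<dots> = ennreal \<eta>" using \<eta> by (simp add: ennreal_plus[symmetric] del: ennreal_plus)
        finally have Bad: "Bad1 \<union> Bad2 \<in> sets (M n)" "emeasure (M n) (Bad1 \<union> Bad2) \<le> ennreal \<eta>"
          using Bad1 Bad2 by auto
        define K where "K = sqrt (E n) * real n powr (w/4)"
        have K: "K > 0" using pos n by (simp add: K_def)
        define L where "L = l1_norm (\<Delta> n *\<^sub>v \<beta>\<^sub>0 n)"
        have L: "L > 0"
          using l1_norm_eq_0_iff[OF mult_mat_vec_carrier[OF Delta beta0]] nzn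
            l1_norm_nonneg[of "\<Delta> n *\<^sub>v \<beta>\<^sub>0 n"] by (simp add: L_def less_le)
        \<comment> \<open>The leading factor of \<open>lam n\<close> is a power of \<open>K\<close>,
          which links it to the supremum bound.\<close>
        have Kq: "K powr (2 / (1 + w/2)) = E n powr (1 / (1 + w/2)) * real n powr ((w/2) / (1 + w/2))"
          using pos n by (simp add: K_def powr_mult powr_half_sqrt[symmetric] powr_powr)
        have bound: "(l2_norm (betahat n \<omega> - \<beta>\<^sub>0 n))\<^sup>2 / real n \<le> (8 * C2 + C3) * rate n"
          if \<omega>: "\<omega> \<in> space (M n) - (Bad1 \<union> Bad2)" for \<omega>
        proof -
          define d where "d = l2_norm (betahat n \<omega> - \<beta>\<^sub>0 n)"
          define N where "N = C2 * real (kernel_dim (\<Delta> n))"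
          have b: "is_gen_lasso n (\<Delta> n) (lam n) (\<beta>\<^sub>0 n + \<epsilon> n \<omega>) (betahat n \<omega>)"
            using lasso data \<omega> by (metis DiffD1)
          have e: "\<epsilon> n \<omega> \<in> carrier_vec n" using \<omega> by simp
          have sN: "(\<Sum>u\<in>U. (\<epsilon> n \<omega> \<bullet> u)\<^sup>2) \<le> N"
            using \<omega> by (auto simp: Bad2_def N_def)
          have sup: "\<bar>\<epsilon> n \<omega> \<bullet> x\<bar> \<le> C * K * l2_norm x powr (1 - w/2)" if "x \<in> unit_row_set n (\<Delta> n)" for x
            using Bad1(3)[OF _ that, of \<omega>] \<omega> by (auto simp: K_def)
          have CK: "C * K \<ge> 0" using C K by simp
          have "1/2 * d\<^sup>2 \<le> sqrt N * d
              + C * K * (l1_norm (\<Delta> n *\<^sub>v betahat n \<omega>) + L) powr (w/2) * d powr (1 - w/2)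
              + lam n * (L - l1_norm (\<Delta> n *\<^sub>v betahat n \<omega>))"
            using gen_lasso_error_bound[OF Delta beta0 e b U(1,3,4) sN sup CK pos(1) w nzn]
            unfolding d_def L_def .
          then have "1/2 * d\<^sup>2 \<le> sqrt N * d
              + C * K * (l1_norm (\<Delta> n *\<^sub>v betahat n \<omega>) + L) powr (w/2) * d powr (1 - w/2)
              + K powr (2 / (1 + w/2)) * L powr (- ((1 - w/2) / (1 + w/2))) * (L - l1_norm (\<Delta> n *\<^sub>v betahat n \<omega>))"
            using lam unfolding Kq L_def by simp
          then have "d\<^sup>2 \<le> 8 * N + C3 * (K powr (2 / (1 + w/2)) * L powr (w / (1 + w/2)))"
            unfolding C3_def
            using C2(1) by (intro error_rate_algebra[OF pos(1) w C(1) K L]) (auto simp: d_def N_def l1_norm_nonneg l2_norm_nonneg)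
          then have "d\<^sup>2 / real n \<le> (8 * N + C3 * (K powr (2 / (1 + w/2)) * L powr (w / (1 + w/2)))) / real n"
            by (rule divide_right_mono) simp
          also have "\<dots> = 8 * C2 * (real (kernel_dim (\<Delta> n)) / real n)
              + C3 * (K powr (2 / (1 + w/2)) / real n * L powr (w / (1 + w/2)))"
            by (simp add: N_def add_divide_distrib)
          also have "K powr (2 / (1 + w/2)) / real n = E n powr (1 / (1 + w/2)) * real n powr (- (1 / (1 + w/2)))"
          proof -
            have "(w/2) / (1 + w/2) - 1 = - (1 / (1 + w/2))" using pos(1) by (simp add: field_simps)
            moreover have "real n powr ((w/2) / (1 + w/2)) / real n = real n powr ((w/2) / (1 + w/2) - 1)"
              using n by (simp add: powr_diff)
            ultimately show ?thesis unfolding Kq by (simp only: times_divide_eq_right[symmetric])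
          qed
          also have "8 * C2 * (real (kernel_dim (\<Delta> n)) / real n)
              + C3 * (E n powr (1 / (1 + w/2)) * real n powr (- (1 / (1 + w/2))) * L powr (w / (1 + w/2)))
              \<le> (8 * C2 + C3) * (real (kernel_dim (\<Delta> n)) / real n)
              + (8 * C2 + C3) * (E n powr (1 / (1 + w/2)) * real n powr (- (1 / (1 + w/2))) * L powr (w / (1 + w/2)))"
            using C2 C3 by (intro add_mono mult_right_mono) auto
          also have "\<dots> = (8 * C2 + C3) * rate n" by (simp add: rate_def L_def distrib_left)
          finally show ?thesis by (simp add: d_def)
        qed
        show "outer_measure_of (M n)
          {\<omega> \<in> space (M n). \<bar>ereal ((l2_norm (betahat n \<omega> - \<beta>\<^sub>0 n))\<^sup>2 / real n)\<bar> > ereal ((8 * C2 + C3) * rate n)} \<le> ennreal \<eta>"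
          using bound by (intro outer_measure_of_le[OF Bad(1) _ Bad(2)]) (auto simp: not_less[symmetric])
      qed
    qed
    then show "bounded_in_prob M
           (\<lambda>n \<omega>. ereal ((l2_norm (betahat n \<omega> - \<beta>\<^sub>0 n))\<^sup>2 / real n))
           (\<lambda>n. real (kernel_dim (\<Delta> n)) / real n
              + E n powr (1 / (1 + w/2)) * real n powr (- (1 / (1 + w/2)))
                * l1_norm (\<Delta> n *\<^sub>v \<beta>\<^sub>0 n) powr (w / (1 + w/2)))"
      by (simp add: rate_def[abs_def])
  qed simp
qed

end
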